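(* Let $\mathfrak{R}=(D,\mathcal{M},\pi)$ be a matroid-rooted digraph with $D=(V,A)$, $\mathcal{M}=(S,\mathcal{I})$, let $t\in V$, let $T$ be the $\subseteq$-largest $t$-good set, and let $\mathcal{P}=\{P_i\}_{i\in I}$ be an $(I,\{t\})$-linkage (with $I\in\mathcal{I}$). If $\mathcal{P}$ and $T$ do not satisfy the complementarity conditions, then there is a $\{t\}$-linkable $I'\in\mathcal{I}$ with $\mathsf{span}(I')\supsetneq\mathsf{span}(I)$.
   Context: Matroids may be infinite (axioms of Bruhn et al.); $\mathsf{span}$ is the closure operator; a base of $S'\subseteq S$ is a base of the restriction to $S'$. Paths are finite directed paths without repeated vertices. A matroid-rooted digraph is $(D,\mathcal{M},\pi)$ with $D=(V,A)$ a digraph (parallel edges allowed, no loops), $\mathcal{M}=(S,\mathcal{I})$ a matroid, $\pi:S\to\mathcal{P}(V)\setminus\{\varnothing\}$. For $X\subseteq V$, $\mathcal{S}(X)=\{i\in S:\pi(i)\cap X\ne\varnothing\}$, $\mathsf{in}_D(X)$ is the set of edges entering $X$, $D[X]$ the induced subdigraph. For $I\in\mathcal{I}$ and $Y\subseteq V$ an $(I,Y)$-linkage is a family of pairwise edge-disjoint paths $\{P_i\}_{i\in I}$ with $P_i$ from a vertex of $\pi(i)$ to a vertex of $Y$; $I$ is $Y$-linkable if one exists. A set $X\subseteq V$ is $t$-good if there is a system of pairwise edge-disjoint paths $\{P_b\}_{b\in B}\cup\{P_e\}_{e\in\mathsf{in}_D(X)}$ in $D[X]$ with $B$ a base of $\mathcal{S}(X)$,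 $P_b$ from $\pi(b)$ to $t$, $P_e$ from $\mathsf{head}(e)$ to $t$; a $\subseteq$-largest $t$-good set exists. The complementarity conditions for an $(I,\{t\})$-linkage $\{P_i\}_{i\in I}$ and a vertex set $X\ni t$ are: (1) $I_{in}:=I\cap\mathcal{S}(X)$ is a base of $\mathcal{S}(X)$; (2) the paths $P_i$, $i\in I_{in}$, lie in $D[X]$; (3) for $i\in I_{out}:=I\setminus\mathcal{S}(X)$ we have $|A(P_i)\cap\mathsf{in}_D(X)|=1$; (4) $\bigcup_{i\in I_{out}}A(P_i)\supseteq\mathsf{in}_D(X)$. *)

theory Defs
  imports
    "Graph_Theory.Digraph"
    "Graph_Theory.Arc_Walk"
    "Graph_Theory.Digraph_Component"
    "HOL-Library.Disjoint_Sets"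
begin

definition incl_maximal :: "'s set set \<Rightarrow> 's set \<Rightarrow> bool" where
  "incl_maximal F B \<longleftrightarrow> B \<in> F \<and> (\<forall>J\<in>F. B \<subseteq> J \<longrightarrow> J = B)"

definition restrict_indep :: "'s set set \<Rightarrow> 's set \<Rightarrow> 's set set" where
  "restrict_indep \<I> X = {J \<in> \<I>. J \<subseteq> X}"

definition base_of :: "'s set set \<Rightarrow> 's set \<Rightarrow> 's set \<Rightarrow> bool" where
  "base_of \<I> X B \<longleftrightarrow> incl_maximal (restrict_indep \<I> X) B"

text \<open>
  Independence axioms (I1), (I2), (I3), (IM) of Bruhn, Diestel, Kriesell, Pendavingh and Wollan
  for matroids on a ground set of arbitrary cardinality.
\<close>

locale infinite_matroid =
  fixes S :: "'s set" and \<I> :: "'s set set"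
  assumes indep_subset_ground: "I \<in> \<I> \<Longrightarrow> I \<subseteq> S"
    and indep_empty: "{} \<in> \<I>"
    and indep_subset: "I \<in> \<I> \<Longrightarrow> J \<subseteq> I \<Longrightarrow> J \<in> \<I>"
    and indep_augment:
      "I \<in> \<I> \<Longrightarrow> \<not> incl_maximal \<I> I \<Longrightarrow> incl_maximal \<I> B \<Longrightarrow> \<exists>x\<in>B - I. insert x I \<in> \<I>"
    and indep_maximal:
      "I \<in> \<I> \<Longrightarrow> I \<subseteq> X \<Longrightarrow> X \<subseteq> S \<Longrightarrow> \<exists>M. incl_maximal {J \<in> \<I>. I \<subseteq> J \<and> J \<subseteq> X} M"

definition matroid_span :: "'s set \<Rightarrow> 's set set \<Rightarrow> 's set \<Rightarrow> 's set" where
  "matroid_span S \<I> X = X \<union> {x \<in> S. \<exists>J. J \<subseteq> X \<and> J \<in> \<I> \<and> insert x J \<notin> \<I>}"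

text \<open>The digraph locale used here allows parallel arcs and infinitely many vertices and arcs.\<close>

locale matroid_rooted_digraph =
  loopfree_digraph D + infinite_matroid S \<I>
  for D :: "('v, 'e) pre_digraph" and S :: "'s set" and \<I> :: "'s set set" +
  fixes \<pi> :: "'s \<Rightarrow> 'v set"
  assumes root_sub: "i \<in> S \<Longrightarrow> \<pi> i \<subseteq> verts D"
    and root_nonempty: "i \<in> S \<Longrightarrow> \<pi> i \<noteq> {}"

definition rooted_in :: "'s set \<Rightarrow> ('s \<Rightarrow> 'v set) \<Rightarrow> 'v set \<Rightarrow> 's set" where
  "rooted_in S \<pi> X = {i \<in> S. \<pi> i \<inter> X \<noteq> {}}"

definition entering :: "('v, 'e) pre_digraph \<Rightarrow> 'v set \<Rightarrow> 'e set" where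
  "entering D X = {e \<in> arcs D. tail D e \<notin> X \<and> head D e \<in> X}"

text \<open>
  A path is encoded by its first vertex and its list of arcs; the first vertex is
  needed for the trivial paths, whose arc list is empty.
\<close>

type_synonym ('v, 'e) dpath = "'v \<times> 'e awalk"

definition path_from_to ::
    "('v, 'e) pre_digraph \<Rightarrow> 'v set \<Rightarrow> ('v, 'e) dpath \<Rightarrow> 'v set \<Rightarrow> bool" where
  "path_from_to D U P Y \<longleftrightarrow> fst P \<in> U \<and> (\<exists>y\<in>Y. pre_digraph.apath D (fst P) (snd P) y)"

definition path_arcs :: "('v, 'e) dpath \<Rightarrow> 'e set" where
  "path_arcs P = set (snd P)"

definition path_verts :: "('v, 'e) pre_digraph \<Rightarrow> ('v, 'e) dpath \<Rightarrow> 'v set" where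
  "path_verts D P = set (pre_digraph.awalk_verts D (fst P) (snd P))"

definition linkage ::
    "('v, 'e) pre_digraph \<Rightarrow> ('s \<Rightarrow> 'v set) \<Rightarrow> 's set \<Rightarrow> 'v set \<Rightarrow> ('s \<Rightarrow> ('v, 'e) dpath) \<Rightarrow> bool" where
  "linkage D \<pi> I Y P \<longleftrightarrow>
     (\<forall>i\<in>I. path_from_to D (\<pi> i) (P i) Y) \<and> disjoint_family_on (\<lambda>i. path_arcs (P i)) I"

definition linkable ::
    "('v, 'e) pre_digraph \<Rightarrow> ('s \<Rightarrow> 'v set) \<Rightarrow> 's set \<Rightarrow> 'v set \<Rightarrow> bool" where
  "linkable D \<pi> I Y \<longleftrightarrow> (\<exists>P. linkage D \<pi> I Y P)"

text \<open>
  The path system of a good set is one family over the disjoint union of the base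
  and the set of entering arcs, so that disjointness is also required across the two kinds of paths.
\<close>

definition t_good ::
    "('v, 'e) pre_digraph \<Rightarrow> 's set \<Rightarrow> 's set set \<Rightarrow> ('s \<Rightarrow> 'v set) \<Rightarrow> 'v \<Rightarrow> 'v set \<Rightarrow> bool" where
  "t_good D S \<I> \<pi> t X \<longleftrightarrow> X \<subseteq> verts D \<and>
     (\<exists>B (P :: 's + 'e \<Rightarrow> ('v, 'e) dpath).
        base_of \<I> (rooted_in S \<pi> X) B \<and>
        (\<forall>b\<in>B. path_from_to (D \<restriction> X) (\<pi> b) (P (Inl b)) {t}) \<and>
        (\<forall>e\<in>entering D X. path_from_to (D \<restriction> X) {head D e} (P (Inr e)) {t}) \<and>
        disjoint_family_on (\<lambda>k. path_arcs (P k)) (B <+> entering D X))"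

definition largest_t_good ::
    "('v, 'e) pre_digraph \<Rightarrow> 's set \<Rightarrow> 's set set \<Rightarrow> ('s \<Rightarrow> 'v set) \<Rightarrow> 'v \<Rightarrow> 'v set \<Rightarrow> bool" where
  "largest_t_good D S \<I> \<pi> t T \<longleftrightarrow>
     t_good D S \<I> \<pi> t T \<and> (\<forall>X. t_good D S \<I> \<pi> t X \<longrightarrow> X \<subseteq> T)"

definition complementarity ::
    "('v, 'e) pre_digraph \<Rightarrow> 's set \<Rightarrow> 's set set \<Rightarrow> ('s \<Rightarrow> 'v set) \<Rightarrow>
     's set \<Rightarrow> ('s \<Rightarrow> ('v, 'e) dpath) \<Rightarrow> 'v set \<Rightarrow> bool" where
  "complementarity D S \<I> \<pi> I P X \<longleftrightarrow>
     (let I_in = I \<inter> rooted_in S \<pi> X; I_out = I - rooted_in S \<pi> X in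
        base_of \<I> (rooted_in S \<pi> X) I_in \<and>
        (\<forall>i\<in>I_in. path_verts D (P i) \<subseteq> verts (D \<restriction> X) \<and> path_arcs (P i) \<subseteq> arcs (D \<restriction> X)) \<and>
        (\<forall>i\<in>I_out. card (path_arcs (P i) \<inter> entering D X) = 1) \<and>
        entering D X \<subseteq> (\<Union>i\<in>I_out. path_arcs (P i)))"

end

theory Submission
  imports Defs
begin

text \<open>
  Let \<open>B\<close> and \<open>Q\<close> witness that \<open>T\<close> is good. Cutting every path of the linkage that starts outside
  \<open>T\<close> at its first arc into \<open>T\<close> and continuing along \<open>Q\<close> links an independent set \<open>B \<union> L\<close>
  spanning \<open>I\<close>. If it spans no more than \<open>I\<close>, the failure of complementarity leaves some arc
  entering \<open>T\<close> unused. Search backwards from this arc in the residual digraph, where besides the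
  usual moves along arcs one may exchange a root within a fundamental circuit. Either the search
  meets a root outside \<open>span (B \<union> L)\<close>, and a shortest residual walk yields an augmentation that
  changes only finitely many paths; or the set \<open>R\<close> of vertices reached makes \<open>T \<union> R\<close> good,
  contradicting the maximality of \<open>T\<close>.
\<close>

section \<open>Disjoint families and shortest walks\<close>

lemma disjoint_family_on_reindex:
  assumes "disjoint_family_on A N" "inj_on \<iota> M" "\<iota> ` M \<subseteq> N"
  shows "disjoint_family_on (\<lambda>k. A (\<iota> k)) M"
  using assms unfolding disjoint_family_on_def inj_on_def by blast

lemma disjoint_family_on_case_sum:
  assumes "disjoint_family_on A M" "disjoint_family_on C N"
    and "\<And>m n. m \<in> M \<Longrightarrow> n \<in> N \<Longrightarrow> A m \<inter> C n = {}"
  shows "disjoint_family_on (case_sum A C) (M <+> N)"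
  unfolding disjoint_family_on_def
proof (intro ballI impI)
  fix k l assume "k \<in> M <+> N" "l \<in> M <+> N" "k \<noteq> l"
  then show "case_sum A C k \<inter> case_sum A C l = {}"
    using assms by (elim PlusE) (simp_all add: disjoint_family_on_def Int_commute)
qed

lemma disjoint_family_on_Cons_update:
  assumes "disjoint_family_on (\<lambda>i. set (a i)) K" "\<And>i. i \<in> K \<Longrightarrow> f \<notin> set (a i)"
  shows "disjoint_family_on (\<lambda>i. set ((a(k := f # a k)) i)) K"
  using assms unfolding disjoint_family_on_def by auto

lemma rtranclp_shortest_walk:
  assumes "R\<^sup>*\<^sup>* x y" "P y"
  obtains n v where "v 0 = x" "P (v n)" "\<forall>i<n. R (v i) (v (Suc i)) \<and> \<not> P (v i)"
    and "\<forall>i k. Suc i < k \<longrightarrow> k \<le> n \<longrightarrow> \<not> R (v i) (v k)" "inj_on v {..n}"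
proof -
  define reaches where "reaches n \<longleftrightarrow> (\<exists>y. (R ^^ n) x y \<and> P y)" for n
  define n where "n = (LEAST n. reaches n)"
  have "\<exists>n. reaches n" using assms by (auto simp: reaches_def rtranclp_power)
  then have "reaches n" unfolding n_def by (rule LeastI_ex)
  then obtain v where v: "v 0 = x" "P (v n)" "\<And>i. i < n \<Longrightarrow> R (v i) (v (Suc i))"
    unfolding reaches_def relpowp_fun_conv by blast
  have minimal: "n \<le> m" if "(R ^^ m) x y" "P y" for m y
    using that unfolding n_def reaches_def by (intro Least_le) blast
  have segment: "(R ^^ (k - i)) (v i) (v k)" if "i \<le> k" "k \<le> n" for i k
    unfolding relpowp_fun_conv using that v(3) by (intro exI[of _ "\<lambda>l. v (i + l)"]) auto
  then have from_x: "(R ^^ i) x (v i)" if "i \<le> n" for i using that v(1) by force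
  have steps: "\<forall>i<n. R (v i) (v (Suc i)) \<and> \<not> P (v i)"
    using v(3) minimal from_x by (meson less_imp_le not_le)
  have no_shortcut: "\<not> R (v i) (v k)" if ik: "Suc i < k" "k \<le> n" for i k
  proof
    assume "R (v i) (v k)"
    then have "(R ^^ Suc i) x (v k)" using from_x[of i] ik by (intro relpowp_Suc_I) auto
    then have "(R ^^ (Suc i + (n - k))) x (v n)"
      using segment[of k n] ik by (intro relpowp_trans) auto
    then show False using minimal[OF _ v(2)] ik by fastforce
  qed
  have "v i \<noteq> v k" if ik: "i < k" "k \<le> n" for i k
  proof (cases "k = n")
    case True
    then show ?thesis using steps v(2) ik by auto
  next
    case False
    then show ?thesis using steps no_shortcut[of i "Suc k"] ik by auto
  qed
  then have "inj_on v {..n}" by (metis atMost_iff inj_onI linorder_neqE_nat)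
  then show thesis using that v(1,2) steps no_shortcut by blast
qed

section \<open>Span and bases in infinite matroids\<close>

lemma base_ofD:
  assumes "base_of \<I> X B"
  shows "B \<in> \<I>" "B \<subseteq> X" "\<And>J. J \<in> \<I> \<Longrightarrow> J \<subseteq> X \<Longrightarrow> B \<subseteq> J \<Longrightarrow> J = B"
  using assms by (auto simp: base_of_def incl_maximal_def restrict_indep_def)

lemma base_ofI:
  assumes "B \<in> \<I>" "B \<subseteq> X" "\<And>J. J \<in> \<I> \<Longrightarrow> J \<subseteq> X \<Longrightarrow> B \<subseteq> J \<Longrightarrow> J = B"
  shows "base_of \<I> X B"
  using assms by (auto simp: base_of_def incl_maximal_def restrict_indep_def)

context infinite_matroid
begin

abbreviation span :: "'s set \<Rightarrow> 's set" where
  "span \<equiv> matroid_span S \<I>"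

lemma indep_extends_to_base_of:
  assumes "I \<in> \<I>" "I \<subseteq> X" "X \<subseteq> S"
  obtains B where "base_of \<I> X B" "I \<subseteq> B"
proof -
  obtain B where "incl_maximal {J \<in> \<I>. I \<subseteq> J \<and> J \<subseteq> X} B"
    using indep_maximal[OF assms] by blast
  then have B: "B \<in> \<I>" "B \<subseteq> X" "I \<subseteq> B"
    and maximal: "\<And>J. J \<in> \<I> \<Longrightarrow> I \<subseteq> J \<Longrightarrow> J \<subseteq> X \<Longrightarrow> B \<subseteq> J \<Longrightarrow> J = B"
    by (auto simp: incl_maximal_def)
  have "base_of \<I> X B"
    using maximal order_trans[OF B(3)] by (intro base_ofI[OF B(1,2)]) simp
  then show thesis using B(3) by (rule that)
qed

lemma base_of_insert_dependent:
  assumes "base_of \<I> X B" "x \<in> X" "x \<notin> B"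
  shows "insert x B \<notin> \<I>"
  using base_ofD(2)[OF assms(1)] base_ofD(3)[OF assms(1), of "insert x B"] assms(2,3) by auto

lemma base_ofI_insert:
  assumes "B \<in> \<I>" "B \<subseteq> X" "\<And>x. x \<in> X \<Longrightarrow> x \<notin> B \<Longrightarrow> insert x B \<notin> \<I>"
  shows "base_of \<I> X B"
proof (rule base_ofI)
  fix J assume J: "J \<in> \<I>" "J \<subseteq> X" "B \<subseteq> J"
  have False if "x \<in> J" "x \<notin> B" for x
    using indep_subset[OF J(1), of "insert x B"] assms(3) J(2,3) that by blast
  then show "J = B" using J(3) by blast
qed (use assms in auto)

lemma incl_maximal_iff_base_of: "incl_maximal \<I> B \<longleftrightarrow> base_of \<I> S B"
proof -
  have "restrict_indep \<I> S = \<I>" using indep_subset_ground by (auto simp: restrict_indep_def)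
  then show ?thesis by (simp add: base_of_def)
qed

lemma base_of_Int_extension:
  assumes "base_of \<I> X B" "B \<subseteq> J" "J \<in> \<I>"
  shows "J \<inter> X = B"
  using base_ofD(2)[OF assms(1)] base_ofD(3)[OF assms(1), of "J \<inter> X"]
    indep_subset[OF assms(3), of "J \<inter> X"] assms(2) by auto

lemma base_of_Un_incl_maximal:
  assumes "base_of \<I> (X \<union> M) B" "incl_maximal \<I> M"
  shows "incl_maximal \<I> B"
proof (rule ccontr)
  assume "\<not> incl_maximal \<I> B"
  then obtain x where "x \<in> M - B" "insert x B \<in> \<I>"
    using indep_augment[OF base_ofD(1)[OF assms(1)]] assms(2) by blast
  then show False using base_of_insert_dependent[OF assms(1)] by blast
qed

text \<open>Axiom (I3) for the restriction to \<open>X\<close>: extend \<open>insert y I\<close> to a base \<open>M\<close> of the matroid and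
  \<open>B\<close> to a base \<open>B'\<close> inside \<open>B \<union> M\<close>; then augment \<open>M - {y}\<close> from \<open>B'\<close>.\<close>

lemma indep_augment_from_base_of:
  assumes B: "base_of \<I> X B" and X: "X \<subseteq> S" and y: "insert y I \<in> \<I>" "insert y I \<subseteq> X" "y \<notin> I"
  shows "\<exists>x\<in>B - I. insert x I \<in> \<I>"
proof -
  obtain M where M: "base_of \<I> S M" "insert y I \<subseteq> M"
    using indep_extends_to_base_of[OF y(1)] indep_subset_ground[OF y(1)] by blast
  have M_indep: "M \<in> \<I>" and M_sub: "M \<subseteq> S" and M_max: "incl_maximal \<I> M"
    using base_ofD[OF M(1)] M(1) by (auto simp: incl_maximal_iff_base_of)
  obtain B' where B': "base_of \<I> (B \<union> M) B'" "B \<subseteq> B'"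
    using indep_extends_to_base_of[of B "B \<union> M"] base_ofD[OF B] X M_sub by blast
  have "M - {y} \<in> \<I>" by (rule indep_subset[OF M_indep]) blast
  moreover have "\<not> incl_maximal \<I> (M - {y})"
    using M(2) M_indep unfolding incl_maximal_def by blast
  ultimately obtain x where x: "x \<in> B' - (M - {y})" "insert x (M - {y}) \<in> \<I>"
    using indep_augment[OF _ _ base_of_Un_incl_maximal[OF B'(1) M_max]] by blast
  have "B' \<inter> X = B" using base_of_Int_extension[OF B B'(2) base_ofD(1)[OF B'(1)]] .
  then have "x \<in> B" using x(1) base_ofD(2)[OF B'(1)] y(2) by blast
  moreover have "x \<notin> I" using x(1) M(2) y(3) by blast
  moreover have "insert x I \<in> \<I>" by (rule indep_subset[OF x(2)]) (use M(2) y(3) in blast)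
  ultimately show ?thesis by blast
qed

lemma span_superset: "X \<subseteq> span X"
  by (auto simp: matroid_span_def)

lemma span_mono: "X \<subseteq> Y \<Longrightarrow> span X \<subseteq> span Y"
  by (auto simp: matroid_span_def)

lemma span_subset_ground: "X \<subseteq> S \<Longrightarrow> span X \<subseteq> S"
  by (auto simp: matroid_span_def)

lemma indep_insert_iff:
  assumes "I \<in> \<I>" "x \<in> S" "x \<notin> I"
  shows "insert x I \<in> \<I> \<longleftrightarrow> x \<notin> span I"
proof
  assume "insert x I \<in> \<I>"
  then show "x \<notin> span I"
    using assms indep_subset[OF _ insert_mono] unfolding matroid_span_def by auto
qed (use assms in \<open>auto simp: matroid_span_def\<close>)

lemma indep_notin_span_remove:
  assumes "I \<in> \<I>" "x \<in> I"
  shows "x \<notin> span (I - {x})"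
  using indep_insert_iff[of "I - {x}" x] indep_subset[of I "I - {x}"] indep_subset_ground assms
  by (auto simp: insert_absorb)

lemma base_of_span:
  assumes "I \<in> \<I>"
  shows "base_of \<I> (span I) I"
proof (rule base_ofI_insert[OF assms span_superset])
  fix x assume "x \<in> span I" "x \<notin> I"
  then show "insert x I \<notin> \<I>"
    using indep_insert_iff[OF assms] span_subset_ground[OF indep_subset_ground[OF assms]] by auto
qed

lemma span_subset_span_base_of:
  assumes B: "base_of \<I> X B" and X: "X \<subseteq> S"
  shows "span X \<subseteq> span B"
proof (rule subsetI, rule ccontr)
  fix x assume x: "x \<in> span X" "x \<notin> span B"
  then have x_S: "x \<in> S" and x_B: "x \<notin> B"
    using span_subset_ground[OF X] span_superset[of B] by auto
  then have x_indep: "insert x B \<in> \<I>" using indep_insert_iff[OF base_ofD(1)[OF B]] x(2) by blast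
  then have "x \<notin> X" using base_of_insert_dependent[OF B] x_B by blast
  then obtain J where J: "J \<subseteq> X" "J \<in> \<I>" "insert x J \<notin> \<I>"
    using x(1) by (auto simp: matroid_span_def)
  obtain J' where J': "base_of \<I> X J'" "J \<subseteq> J'" using indep_extends_to_base_of[OF J(2,1) X] .
  have "insert x J' \<notin> \<I>" using J(3) indep_subset[OF _ insert_mono[OF J'(2)]] by auto
  then have "base_of \<I> (insert x X) J'"
    using base_ofD[OF J'(1)] base_of_insert_dependent[OF J'(1)] by (intro base_ofI_insert) auto
  then obtain z where "z \<in> J' - B" "insert z B \<in> \<I>"
    using indep_augment_from_base_of[of "insert x X" J' x B] x_indep X x_S base_ofD(2)[OF B] x_B
    by auto
  then show False using base_of_insert_dependent[OF B] base_ofD(2)[OF J'(1)] by blast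
qed

lemma base_of_subset_span:
  assumes "base_of \<I> X B" "X \<subseteq> S"
  shows "X \<subseteq> span B"
  using span_subset_span_base_of[OF assms] span_superset[of X] by blast

lemma span_minimal:
  assumes "Y \<subseteq> S" "X \<subseteq> span Y"
  shows "span X \<subseteq> span Y"
proof -
  obtain B where B: "base_of \<I> Y B"
    using indep_extends_to_base_of[OF indep_empty empty_subsetI assms(1)] .
  have "X \<subseteq> span B" using assms(2) span_subset_span_base_of[OF B assms(1)] by blast
  then have "span X \<subseteq> span (span B)" by (rule span_mono)
  also have "\<dots> \<subseteq> span B"
    using span_subset_span_base_of[OF base_of_span] span_subset_ground indep_subset_ground
      base_ofD(1)[OF B] by simp
  also have "\<dots> \<subseteq> span Y" using span_mono[OF base_ofD(2)[OF B]] .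
  finally show ?thesis .
qed

lemma base_ofI_span:
  assumes "B \<in> \<I>" "B \<subseteq> X" "X \<subseteq> span B"
  shows "base_of \<I> X B"
  using base_of_insert_dependent[OF base_of_span[OF assms(1)]] assms
  by (intro base_ofI_insert) auto

lemma
  assumes K: "K \<in> \<I>" "j \<in> K" and s: "s \<in> span K" "s \<notin> span (K - {j})"
  shows indep_exchange: "insert s (K - {j}) \<in> \<I>"
    and subset_span_exchange: "K \<subseteq> span (insert s (K - {j}))"
proof -
  have s_S: "s \<in> S" using s span_subset_ground[OF indep_subset_ground[OF K(1)]] by auto
  have s_K: "s \<notin> K - {j}" using s(2) span_superset[of "K - {j}"] by auto
  show indep: "insert s (K - {j}) \<in> \<I>"
    using indep_insert_iff[OF indep_subset[OF K(1)] s_S s_K] s(2) by blast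
  have "j \<in> span (insert s (K - {j}))"
  proof (cases "s = j")
    case False
    then have "insert s K \<notin> \<I>" using indep_insert_iff[OF K(1) s_S] s(1) s_K by auto
    moreover have "insert s K = insert j (insert s (K - {j}))" using K(2) by blast
    ultimately show ?thesis
      using indep_insert_iff[OF indep, of j] indep_subset_ground K False by auto
  qed (use span_superset[of "insert s (K - {j})"] in auto)
  then show "K \<subseteq> span (insert s (K - {j}))"
    using span_superset[of "insert s (K - {j})"] by blast
qed

text \<open>No shortcuts: \<open>s i\<close> is already spanned without the elements \<open>j k\<close> that leave after \<open>j i\<close>.
  Hence an exchange keeps the later exchanges possible.\<close>

lemma
  fixes W :: "'k :: linorder set"
  assumes I: "I \<in> \<I>" and W: "finite W"
    and j: "\<And>i. i \<in> W \<Longrightarrow> j i \<in> I"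
    and s: "\<And>i. i \<in> W \<Longrightarrow> s i \<in> span I" "\<And>i. i \<in> W \<Longrightarrow> s i \<notin> span (I - {j i})"
    and no_shortcut: "\<And>i k. i \<in> W \<Longrightarrow> k \<in> W \<Longrightarrow> i < k \<Longrightarrow> s i \<in> span (I - {j k})"
  shows indep_exchange_sequence: "I - j ` W \<union> s ` W \<in> \<I>"
    and subset_span_exchange_sequence: "I \<subseteq> span (I - j ` W \<union> s ` W)"
proof -
  have "I - j ` W \<union> s ` W \<in> \<I> \<and> I \<subseteq> span (I - j ` W \<union> s ` W)"
    using W j s no_shortcut
  proof (induction W rule: finite_linorder_max_induct)
    case empty
    then show ?case using I span_superset[of I] by simp
  next
    case (insert k A)
    let ?K = "I - j ` A \<union> s ` A"
    have K: "?K \<in> \<I>" "I \<subseteq> span ?K" using insert.IH insert.prems by simp_all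
    have s_A: "s ` A \<subseteq> span (I - {j k})" using insert.hyps(2) insert.prems(4) by auto
    have j_A: "j k \<notin> j ` A" using insert by (metis imageE insertCI)
    have j_s: "j k \<notin> s ` A" using s_A indep_notin_span_remove[OF I] insert.prems(1) by blast
    have "?K - {j k} \<subseteq> span (I - {j k})" using s_A span_superset[of "I - {j k}"] by blast
    then have "s k \<notin> span (?K - {j k})"
      using span_minimal[of "I - {j k}"] indep_subset_ground[OF I] insert.prems(3) by blast
    moreover have "s k \<in> span ?K"
      using span_minimal[OF indep_subset_ground[OF K(1)] K(2)] insert.prems(2) by blast
    moreover have "j k \<in> ?K" using insert.prems(1) j_A by blast
    ultimately have "insert (s k) (?K - {j k}) \<in> \<I>" "?K \<subseteq> span (insert (s k) (?K - {j k}))"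
      using indep_exchange subset_span_exchange K(1) by blast+
    moreover have "insert (s k) (?K - {j k}) = I - j ` insert k A \<union> s ` insert k A"
      using j_s by blast
    ultimately have "I - j ` insert k A \<union> s ` insert k A \<in> \<I>"
      "?K \<subseteq> span (I - j ` insert k A \<union> s ` insert k A)" by simp_all
    then show ?case using K(2) span_minimal indep_subset_ground by (meson order_trans)
  qed
  then show "I - j ` W \<union> s ` W \<in> \<I>" "I \<subseteq> span (I - j ` W \<union> s ` W)" by blast+
qed

text \<open>The elements \<open>x\<close> of \<open>I\<close> with \<open>s \<notin> span (I - {x})\<close> form the fundamental circuit of \<open>s\<close> without
  \<open>s\<close> itself; the point is that they already span \<open>s\<close> although \<open>I\<close> may be infinite.\<close>

lemma span_fundamental_circuit:
  assumes I: "I \<in> \<I>" and s: "s \<in> span I" and C: "{x \<in> I. s \<notin> span (I - {x})} \<subseteq> C" "C \<subseteq> I"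
  shows "s \<in> span C"
proof (cases "s \<in> I")
  case True
  then show ?thesis using indep_notin_span_remove[OF I] C span_superset[of C] by auto
next
  case False
  have s_S: "s \<in> S" and ground: "insert s I \<subseteq> S"
    using s span_subset_ground[OF indep_subset_ground[OF I]] indep_subset_ground[OF I] by auto
  have dependent: "insert s I \<notin> \<I>" using indep_insert_iff[OF I s_S False] s by blast
  show ?thesis
  proof (rule ccontr)
    assume "s \<notin> span C"
    then have "insert s C \<in> \<I>"
      using indep_insert_iff[OF indep_subset[OF I C(2)] s_S] False C by blast
    then obtain M where M: "base_of \<I> (insert s I) M" "insert s C \<subseteq> M"
      using indep_extends_to_base_of[of "insert s C" "insert s I"] C ground by blast
    have "M \<noteq> insert s I" using dependent base_ofD(1)[OF M(1)] by blast
    then obtain y where y: "y \<in> I" "y \<notin> M" using M(2) base_ofD(2)[OF M(1)] by blast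
    then obtain x where x: "x \<in> M - (I - {y})" "insert x (I - {y}) \<in> \<I>"
      using indep_augment_from_base_of[OF M(1) ground, of y "I - {y}"] I
      by (auto simp: insert_absorb)
    then have "x = s" using base_ofD(2)[OF M(1)] y by blast
    then have "s \<notin> span (I - {y})"
      using x indep_insert_iff[OF indep_subset[OF I, of "I - {y}"] s_S] by auto
    then show False using C y M(2) by blast
  qed
qed

lemma indep_Un_replace_base_of:
  assumes X: "X \<subseteq> S" and B: "base_of \<I> X B" "base_of \<I> X B'"
    and L: "B \<union> L \<in> \<I>" "L \<inter> X = {}"
  shows "B' \<union> L \<in> \<I>"
proof -
  have ground: "B' \<union> L \<subseteq> S" using base_ofD(2)[OF B(2)] X indep_subset_ground[OF L(1)] by blast
  then obtain M where M: "base_of \<I> (B' \<union> L) M" "B' \<subseteq> M"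
    using indep_extends_to_base_of[of B' "B' \<union> L"] base_ofD(1)[OF B(2)] by blast
  have False if k: "k \<in> L" "k \<notin> M" for k
  proof -
    let ?K = "B \<union> L - {k}"
    have "B \<subseteq> ?K" using k L(2) base_ofD(2)[OF B(1)] by blast
    then have "X \<subseteq> span ?K" using base_of_subset_span[OF B(1) X] span_mono by blast
    then have "M \<subseteq> span ?K"
      using base_ofD(2)[OF M(1)] base_ofD(2)[OF B(2)] k(2) span_superset[of ?K] by blast
    then have "span M \<subseteq> span ?K" using span_minimal[of ?K] indep_subset_ground[OF L(1)] by blast
    then show False
      using base_of_subset_span[OF M(1) ground] indep_notin_span_remove[OF L(1)] k(1) by blast
  qed
  then have "B' \<union> L = M" using M(2) base_ofD(2)[OF M(1)] by blast
  then show ?thesis using base_ofD(1)[OF M(1)] by simp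
qed

lemma base_of_Int_if_spans:
  assumes I: "I \<in> \<I>" and X: "X \<subseteq> S" "X \<subseteq> span I"
    and B: "base_of \<I> X B" "B \<union> (I - X) \<in> \<I>"
  shows "base_of \<I> X (I \<inter> X)"
proof (rule base_ofI_insert)
  show "I \<inter> X \<in> \<I>" by (rule indep_subset[OF I]) blast
  fix s assume s: "s \<in> X" "s \<notin> I \<inter> X"
  show "insert s (I \<inter> X) \<notin> \<I>"
  proof
    assume "insert s (I \<inter> X) \<in> \<I>"
    then obtain B' where B': "base_of \<I> X B'" "insert s (I \<inter> X) \<subseteq> B'"
      using indep_extends_to_base_of[OF _ _ X(1)] s(1) by blast
    have "B' \<union> (I - X) \<in> \<I>" using indep_Un_replace_base_of[OF X(1) B(1) B'(1) B(2)] by blast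
    then have "insert s I \<in> \<I>" by (rule indep_subset) (use B'(2) in blast)
    then show False using indep_insert_iff[OF I, of s] s X by blast
  qed
qed blast

end

section \<open>Walks up to their first entrance into a vertex set\<close>

context wf_digraph
begin

lemma set_awalk_verts_eq_tails: "awalk u p v \<Longrightarrow> set (awalk_verts u p) = insert v (tail G ` set p)"
  by (induction p arbitrary: u) (auto simp: awalk_simps)

lemma awalk_induceI:
  assumes "awalk u p v" "v \<in> X" "tail G ` set p \<subseteq> X"
  shows "pre_digraph.awalk (G \<restriction> X) u p v"
  using assms by (intro awalk_induce) (auto simp: set_awalk_verts_eq_tails)

lemma subgraph_induce_mono: "Y \<subseteq> X \<Longrightarrow> subgraph (G \<restriction> Y) (G \<restriction> X)"
  by (auto simp: subgraph_def compatible_def)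

lemma apath_induce_mono:
  assumes "Y \<subseteq> X" "pre_digraph.apath (G \<restriction> Y) u p v"
  shows "pre_digraph.apath (G \<restriction> X) u p v"
  using wf_digraph.subgraph_apath_imp_apath[OF wellformed_induce_subgraph assms(2)]
    subgraph_induce_mono[OF assms(1)] .

lemma awalk_verts_subset_if_no_entering_arc:
  assumes "awalk u p v" "v \<in> T" "set p \<inter> entering G T = {}"
  shows "set (awalk_verts u p) \<subseteq> T"
  using assms
proof (induction p arbitrary: u)
  case (Cons f p)
  then have walk: "awalk (head G f) p v" by (simp add: awalk_Cons_iff)
  then have "set (awalk_verts (head G f) p) \<subseteq> T" using Cons by simp
  moreover have "head G f \<in> T" using calculation hd_in_awalk_verts(1)[OF walk] by blast
  ultimately show ?case using Cons.prems by (auto simp: awalk_Cons_iff entering_def)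
qed (simp add: awalk_Nil_iff)

definition entry_walk :: "'a set \<Rightarrow> 'a \<Rightarrow> 'b awalk \<Rightarrow> bool" where
  "entry_walk T u p \<longleftrightarrow> tail G ` set p \<inter> T = {} \<and> (\<exists>v\<in>T. awalk u p v)"

lemma entry_walk_Nil [simp]: "entry_walk T u [] \<longleftrightarrow> u \<in> T \<and> u \<in> verts G"
  by (auto simp: entry_walk_def awalk_Nil_iff)

lemma entry_walk_Cons [simp]:
  "entry_walk T u (f # p) \<longleftrightarrow> f \<in> arcs G \<and> tail G f = u \<and> u \<notin> T \<and> entry_walk T (head G f) p"
  by (auto simp: entry_walk_def awalk_Cons_iff)

lemma entry_walk_start_notin_iff: "entry_walk T u p \<Longrightarrow> u \<notin> T \<longleftrightarrow> p \<noteq> []"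
  by (cases p) auto

lemma entry_walk_arcs: "entry_walk T u p \<Longrightarrow> f \<in> set p \<Longrightarrow> f \<in> arcs G \<and> tail G f \<notin> T"
  by (auto simp: entry_walk_def)

lemma entry_walk_suffix: "entry_walk T u (p @ f # q) \<Longrightarrow> entry_walk T (tail G f) (f # q)"
  by (induction p arbitrary: u) auto

lemma entry_walk_Int_entering:
  "entry_walk T u p \<Longrightarrow> p \<noteq> [] \<Longrightarrow> set p \<inter> entering G T = {last p}"
proof (induction p arbitrary: u)
  case (Cons f p)
  then show ?case by (cases p) (auto simp: entering_def)
qed simp

lemma last_entry_walk_entering: "entry_walk T u p \<Longrightarrow> p \<noteq> [] \<Longrightarrow> last p \<in> entering G T"
  using entry_walk_Int_entering by blast

lemma entry_walk_awalk: "entry_walk T u p \<Longrightarrow> p \<noteq> [] \<Longrightarrow> awalk u p (head G (last p))"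
  by (auto simp: entry_walk_def awalk_conv awalk_verts_conv)

lemma inj_on_last_entry_walk:
  assumes "\<And>k. k \<in> K \<Longrightarrow> entry_walk T (u k) (a k) \<and> a k \<noteq> []" "disjoint_family_on (\<lambda>k. set (a k)) K"
  shows "inj_on (\<lambda>k. last (a k)) K"
proof (rule inj_onI)
  fix k l assume kl: "k \<in> K" "l \<in> K" "last (a k) = last (a l)"
  then have "last (a k) \<in> set (a k) \<inter> set (a l)" using assms(1) by (metis IntI last_in_set)
  then show "k = l" using disjoint_family_onD[OF assms(2) kl(1,2)] by blast
qed

definition entry_prefix :: "'a set \<Rightarrow> 'b awalk \<Rightarrow> 'b awalk" where
  "entry_prefix T p = takeWhile (\<lambda>f. tail G f \<notin> T) p"

lemma set_entry_prefix_subset: "set (entry_prefix T p) \<subseteq> set p"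
  by (auto simp: entry_prefix_def dest: set_takeWhileD)

lemma distinct_entry_prefix: "distinct p \<Longrightarrow> distinct (entry_prefix T p)"
  by (simp add: entry_prefix_def)

lemma entry_walk_entry_prefix: "awalk u p v \<Longrightarrow> v \<in> T \<Longrightarrow> entry_walk T u (entry_prefix T p)"
  unfolding entry_prefix_def
  by (induction p arbitrary: u) (auto simp: awalk_simps dest: awalk_hd_in_verts)

end

section \<open>Decomposing a finite flow into walks\<close>

definition num_starts :: "'k set \<Rightarrow> ('k \<Rightarrow> 'v) \<Rightarrow> 'v \<Rightarrow> int" where
  "num_starts K \<sigma> v = (\<Sum>k\<in>K. of_bool (\<sigma> k = v))"

lemma num_starts_fun_upd:
  assumes "finite K" "k \<in> K"
  shows "num_starts K (\<sigma>(k := u)) v = num_starts K \<sigma> v - of_bool (\<sigma> k = v) + of_bool (u = v)"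
proof -
  have "(\<Sum>i\<in>K - {k}. of_bool ((\<sigma>(k := u)) i = v)) = (\<Sum>i\<in>K - {k}. of_bool (\<sigma> i = v) :: int)"
    by (intro sum.cong) auto
  then show ?thesis
    unfolding num_starts_def using assms by (simp add: sum.remove del: sum_of_bool_eq)
qed

lemma num_starts_pos:
  assumes "finite K" "k \<in> K"
  shows "0 < num_starts K \<sigma> (\<sigma> k)"
  unfolding num_starts_def using assms member_le_sum[of k K "\<lambda>i. of_bool (\<sigma> i = \<sigma> k) :: int"]
  by (simp del: sum_of_bool_eq)

context wf_digraph
begin

definition net_outflow :: "'b set \<Rightarrow> 'a \<Rightarrow> int" where
  "net_outflow F v = (\<Sum>f\<in>F. of_bool (tail G f = v) - of_bool (head G f = v))"

lemma net_outflow_insert: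
  "finite F \<Longrightarrow> f \<notin> F \<Longrightarrow>
   net_outflow (insert f F) v = net_outflow F v + of_bool (tail G f = v) - of_bool (head G f = v)"
  by (simp add: net_outflow_def)

lemma net_outflow_remove:
  "finite F \<Longrightarrow> f \<in> F \<Longrightarrow>
   net_outflow (F - {f}) v = net_outflow F v - of_bool (tail G f = v) + of_bool (head G f = v)"
  by (simp add: net_outflow_def sum_diff1)

lemma ex_tail_if_net_outflow_pos:
  assumes "0 < net_outflow F v"
  shows "\<exists>f\<in>F. tail G f = v"
proof (rule ccontr)
  assume "\<not> ?thesis"
  then have "net_outflow F v \<le> 0" unfolding net_outflow_def by (intro sum_nonpos) auto
  then show False using assms by simp
qed

lemma net_outflow_entry_walk:
  "entry_walk T u p \<Longrightarrow> distinct p \<Longrightarrow> v \<notin> T \<Longrightarrow> net_outflow (set p) v = of_bool (u = v)"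
  by (induction p arbitrary: u) (auto simp: net_outflow_def)

lemma net_outflow_UN_entry_walks:
  assumes "finite J" "\<And>j. j \<in> J \<Longrightarrow> entry_walk T (u j) (a j) \<and> distinct (a j)"
    and "disjoint_family_on (\<lambda>j. set (a j)) J" "v \<notin> T"
  shows "net_outflow (\<Union>j\<in>J. set (a j)) v = num_starts J u v"
proof -
  have "net_outflow (\<Union>j\<in>J. set (a j)) v = (\<Sum>j\<in>J. net_outflow (set (a j)) v)"
    unfolding net_outflow_def using assms(1,3)
    by (intro sum.UNION_disjoint) (auto simp: disjoint_family_on_def)
  also have "\<dots> = num_starts J u v"
    unfolding num_starts_def using assms
    by (intro sum.cong net_outflow_entry_walk[where T = T]) auto
  finally show ?thesis .
qed

lemma ex_disjoint_entry_walks: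
  assumes "finite F" "F \<subseteq> arcs G" "tail G ` F \<inter> T = {}" "finite K" "\<sigma> ` K \<subseteq> verts G"
    and "\<And>v. v \<notin> T \<Longrightarrow> num_starts K \<sigma> v \<le> net_outflow F v"
  shows "\<exists>a. (\<forall>k\<in>K. entry_walk T (\<sigma> k) (a k) \<and> set (a k) \<subseteq> F) \<and>
           disjoint_family_on (\<lambda>k. set (a k)) K"
  using assms
proof (induction "card F" arbitrary: F \<sigma> rule: less_induct)
  case less
  note F = less.prems(1-3) and K = less.prems(4,5) and demand = less.prems(6)
  show ?case
  proof (cases "\<sigma> ` K \<subseteq> T")
    case True
    then show ?thesis using K(2) by (intro exI[of _ "\<lambda>_. []"]) (auto simp: disjoint_family_on_def)
  next
    case False
    then obtain k where k: "k \<in> K" "\<sigma> k \<notin> T" by blast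
    then obtain f where f: "f \<in> F" "tail G f = \<sigma> k"
      using ex_tail_if_net_outflow_pos num_starts_pos[OF K(1) k(1), of \<sigma>] demand[OF k(2)]
      by (meson order_less_le_trans)
    let ?\<sigma> = "\<sigma>(k := head G f)"
    have "\<exists>a. (\<forall>i\<in>K. entry_walk T (?\<sigma> i) (a i) \<and> set (a i) \<subseteq> F - {f}) \<and>
        disjoint_family_on (\<lambda>i. set (a i)) K"
    proof (rule less.hyps)
      show "card (F - {f}) < card F" using F(1) f(1) by (rule card_Diff1_less)
      show "?\<sigma> ` K \<subseteq> verts G" using K(2) f(1) F(2) by auto
      show "num_starts K ?\<sigma> v \<le> net_outflow (F - {f}) v" if "v \<notin> T" for v
        unfolding net_outflow_remove[OF F(1) f(1)] num_starts_fun_upd[OF K(1) k(1)] f(2)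
        using demand[OF that] by simp
    qed (use F K in auto)
    then obtain a where a: "\<And>i. i \<in> K \<Longrightarrow> entry_walk T (?\<sigma> i) (a i) \<and> set (a i) \<subseteq> F - {f}"
      and disjoint: "disjoint_family_on (\<lambda>i. set (a i)) K" by blast
    have "disjoint_family_on (\<lambda>i. set ((a(k := f # a k)) i)) K"
      using disjoint a by (intro disjoint_family_on_Cons_update) blast+
    moreover have "entry_walk T (\<sigma> i) ((a(k := f # a k)) i) \<and> set ((a(k := f # a k)) i) \<subseteq> F"
      if i: "i \<in> K" for i
      using a[OF i] a[OF k(1)] f k(2) F(2) by (cases "i = k") auto
    ultimately show ?thesis by blast
  qed
qed

end

section \<open>Linkages behind a good set\<close>

lemma path_from_to_singleton:
  "path_from_to D U p {t} \<longleftrightarrow> fst p \<in> U \<and> pre_digraph.apath D (fst p) (snd p) t"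
  by (simp add: path_from_to_def)

lemma (in wf_digraph) path_from_to_induceD:
  assumes "X \<subseteq> verts G" "path_from_to (G \<restriction> X) U p Y"
  shows "path_from_to G U p Y"
  using assms subgraph_apath_imp_apath subgraph_induce_subgraphI unfolding path_from_to_def by blast

lemma rooted_in_subset: "rooted_in S \<pi> X \<subseteq> S"
  by (auto simp: rooted_in_def)

locale good_set = matroid_rooted_digraph D S \<I> \<pi>
  for D :: "('v, 'e) pre_digraph" and S :: "'s set" and \<I> :: "'s set set"
    and \<pi> :: "'s \<Rightarrow> 'v set" +
  fixes t :: 'v and T :: "'v set" and B :: "'s set" and Q :: "'s + 'e \<Rightarrow> ('v, 'e) dpath"
  assumes T_verts: "T \<subseteq> verts D"
    and B_base: "base_of \<I> (rooted_in S \<pi> T) B"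
    and Q_root: "b \<in> B \<Longrightarrow> path_from_to (D \<restriction> T) (\<pi> b) (Q (Inl b)) {t}"
    and Q_entering: "e \<in> entering D T \<Longrightarrow> path_from_to (D \<restriction> T) {head D e} (Q (Inr e)) {t}"
    and Q_disjoint: "disjoint_family_on (\<lambda>k. path_arcs (Q k)) (B <+> entering D T)"
begin

lemma tail_Q_arcs: "k \<in> B <+> entering D T \<Longrightarrow> tail D ` path_arcs (Q k) \<subseteq> T"
  using Q_root Q_entering
  by (auto simp: path_from_to_singleton path_arcs_def pre_digraph.apath_def pre_digraph.awalk_def)

lemma rooted_in_subset_span: "rooted_in S \<pi> T \<subseteq> span (B \<union> K)"
  using base_of_subset_span[OF B_base rooted_in_subset] span_mono[of B "B \<union> K"] by blast

lemma disjoint_family_on_Un_Q: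
  assumes q: "inj_on q M" "q ` M \<subseteq> B <+> entering D T"
    and A: "disjoint_family_on A M" "\<And>k. k \<in> M \<Longrightarrow> tail D ` A k \<inter> T = {}"
  shows "disjoint_family_on (\<lambda>k. A k \<union> path_arcs (Q (q k))) M"
  unfolding disjoint_family_on_def
proof (intro ballI impI)
  fix k l assume kl: "k \<in> M" "l \<in> M" "k \<noteq> l"
  have "A k \<inter> A l = {}" using disjoint_family_onD[OF A(1) kl] .
  moreover have "path_arcs (Q (q k)) \<inter> path_arcs (Q (q l)) = {}"
    using disjoint_family_onD[OF disjoint_family_on_reindex[OF Q_disjoint q] kl] .
  moreover have "A i \<inter> path_arcs (Q (q m)) = {}" if "i \<in> M" "m \<in> M" for i m
    using A(2)[OF that(1)] tail_Q_arcs[of "q m"] q(2) that(2) by blast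
  ultimately show "(A k \<union> path_arcs (Q (q k))) \<inter> (A l \<union> path_arcs (Q (q l))) = {}"
    using kl by blast
qed

lemma ex_disjoint_paths_via_entering_arcs:
  fixes e :: "'k \<Rightarrow> 'e"
  assumes X: "T \<subseteq> X"
    and e: "inj_on e M" "e ` M \<subseteq> entering D T"
    and p: "\<And>k. k \<in> M \<Longrightarrow> pre_digraph.awalk (D \<restriction> X) (x k) (p k) (head D (e k))"
    and outside: "\<And>k. k \<in> M \<Longrightarrow> tail D ` set (p k) \<inter> T = {}"
    and disjoint: "disjoint_family_on (\<lambda>k. set (p k)) M"
  shows "\<exists>P. (\<forall>b\<in>B. path_from_to (D \<restriction> X) (\<pi> b) (P (Inl b)) {t}) \<and>
    (\<forall>k\<in>M. path_from_to (D \<restriction> X) {x k} (P (Inr k)) {t}) \<and>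
    disjoint_family_on (\<lambda>k. path_arcs (P k)) (B <+> M)"
proof -
  interpret X: wf_digraph "D \<restriction> X" by (rule wellformed_induce_subgraph)
  let ?r = "\<lambda>k. p k @ snd (Q (Inr (e k)))"
  let ?P = "case_sum (\<lambda>b. Q (Inl b)) (\<lambda>k. (x k, X.awalk_to_apath (?r k)))"
  let ?A = "case_sum (\<lambda>_. {}) (\<lambda>k. set (p k))"
  have r: "X.awalk (x k) (?r k) t" if "k \<in> M" for k
  proof -
    have "e k \<in> entering D T" using e(2) that by blast
    then have "X.apath (head D (e k)) (snd (Q (Inr (e k)))) t"
      using Q_entering[of "e k"] apath_induce_mono[OF X] by (auto simp: path_from_to_singleton)
    then show ?thesis by (rule X.awalk_appendI[OF p[OF that] X.awalkI_apath])
  qed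
  have "disjoint_family_on (\<lambda>k. ?A k \<union> path_arcs (Q (map_sum id e k))) (B <+> M)"
  proof (rule disjoint_family_on_Un_Q)
    show "inj_on (map_sum id e) (B <+> M)" using e(1) by (intro inj_onI) (auto dest: inj_onD)
    show "map_sum id e ` (B <+> M) \<subseteq> B <+> entering D T" using e(2) by auto
    show "disjoint_family_on ?A (B <+> M)"
      using disjoint by (intro disjoint_family_on_case_sum) (simp_all add: disjoint_family_on_def)
    show "tail D ` ?A k \<inter> T = {}" if "k \<in> B <+> M" for k
      using that outside by (elim PlusE) simp_all
  qed
  moreover have "path_arcs (?P k) \<subseteq> ?A k \<union> path_arcs (Q (map_sum id e k))" if "k \<in> B <+> M" for k
    using that X.awalk_to_apath_subset[OF r] by (fastforce simp: path_arcs_def)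
  ultimately have "disjoint_family_on (\<lambda>k. path_arcs (?P k)) (B <+> M)"
    unfolding disjoint_family_on_def by blast
  then show ?thesis
    using Q_root apath_induce_mono[OF X] X.apath_awalk_to_apath[OF r]
    by (intro exI[of _ ?P]) (simp add: path_from_to_singleton)
qed

lemma ex_disjoint_paths_along_entry_walks:
  assumes X: "T \<subseteq> X"
    and w: "\<And>k. k \<in> M \<Longrightarrow> entry_walk T (y k) (w k) \<and> w k \<noteq> []"
      "disjoint_family_on (\<lambda>k. set (w k)) M"
    and p: "\<And>k. k \<in> M \<Longrightarrow> awalk (x k) (p k) (head D (last (w k)))"
      "\<And>k. k \<in> M \<Longrightarrow> set (p k) \<subseteq> set (w k)" "\<And>k. k \<in> M \<Longrightarrow> tail D ` set (p k) \<subseteq> X"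
  shows "\<exists>P. (\<forall>b\<in>B. path_from_to (D \<restriction> X) (\<pi> b) (P (Inl b)) {t}) \<and>
    (\<forall>k\<in>M. path_from_to (D \<restriction> X) {x k} (P (Inr k)) {t}) \<and>
    disjoint_family_on (\<lambda>k. path_arcs (P k)) (B <+> M)"
proof (rule ex_disjoint_paths_via_entering_arcs[OF X])
  have entering: "last (w k) \<in> entering D T" if "k \<in> M" for k
    using w(1)[OF that] last_entry_walk_entering by blast
  show "inj_on (\<lambda>k. last (w k)) M" using inj_on_last_entry_walk[OF w] .
  show "(\<lambda>k. last (w k)) ` M \<subseteq> entering D T" using entering by blast
  show "disjoint_family_on (\<lambda>k. set (p k)) M"
    using w(2) p(2) unfolding disjoint_family_on_def by blast
  fix k assume k: "k \<in> M"
  show "pre_digraph.awalk (D \<restriction> X) (x k) (p k) (head D (last (w k)))"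
    using entering[OF k] X by (intro awalk_induceI p k) (auto simp: entering_def)
  show "tail D ` set (p k) \<inter> T = {}"
    using p(2)[OF k] entry_walk_arcs w(1)[OF k] by blast
qed

lemma linkable_entry_walks:
  assumes K: "K \<inter> B = {}" "\<And>k. k \<in> K \<Longrightarrow> u k \<in> \<pi> k - T"
    and a: "\<And>k. k \<in> K \<Longrightarrow> entry_walk T (u k) (a k)" "disjoint_family_on (\<lambda>k. set (a k)) K"
  shows "linkable D \<pi> (B \<union> K) {t}"
proof -
  have walk: "entry_walk T (u k) (a k) \<and> a k \<noteq> []" if "k \<in> K" for k
    using a(1) K(2) that entry_walk_start_notin_iff by blast
  have tails: "tail D ` set (a k) \<subseteq> verts D" if "k \<in> K" for k
    using entry_walk_arcs[OF a(1)[OF that]] by auto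
  obtain P where P: "\<forall>b\<in>B. path_from_to (D \<restriction> verts D) (\<pi> b) (P (Inl b)) {t}"
    "\<forall>k\<in>K. path_from_to (D \<restriction> verts D) {u k} (P (Inr k)) {t}"
    and disjoint: "disjoint_family_on (\<lambda>k. path_arcs (P k)) (B <+> K)"
    using ex_disjoint_paths_along_entry_walks[OF T_verts walk a(2) _ subset_refl tails, of u]
      entry_walk_awalk walk by blast
  let ?\<iota> = "\<lambda>k. if k \<in> B then Inl k else Inr k"
  have "disjoint_family_on (\<lambda>k. path_arcs (P (?\<iota> k))) (B \<union> K)"
    by (rule disjoint_family_on_reindex[OF disjoint]) (auto simp: inj_on_def)
  moreover have "path_from_to D (\<pi> k) (P (?\<iota> k)) {t}" if "k \<in> B \<union> K" for k
  proof (rule path_from_to_induceD[OF subset_refl])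
    show "path_from_to (D \<restriction> verts D) (\<pi> k) (P (?\<iota> k)) {t}"
      using that P K(2) by (cases "k \<in> B") (auto simp: path_from_to_singleton)
  qed
  ultimately show ?thesis
    unfolding linkable_def linkage_def by (intro exI[of _ "\<lambda>k. P (?\<iota> k)"]) blast
qed

end

lemma t_goodI_path_system:
  fixes D :: "('v, 'e) pre_digraph" and P :: "'s + 's + 'e \<Rightarrow> ('v, 'e) dpath"
  assumes "X \<subseteq> verts D" "base_of \<I> (rooted_in S \<pi> X) (B \<union> J)"
    and "\<forall>b\<in>B. path_from_to (D \<restriction> X) (\<pi> b) (P (Inl b)) {t}"
    and "\<forall>b\<in>J. path_from_to (D \<restriction> X) (\<pi> b) (P (Inr (Inl b))) {t}"
    and "\<forall>f\<in>entering D X. path_from_to (D \<restriction> X) {head D f} (P (Inr (Inr f))) {t}"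
    and disjoint: "disjoint_family_on (\<lambda>k. path_arcs (P k)) (B <+> J <+> entering D X)"
  shows "t_good D S \<I> \<pi> t X"
proof -
  let ?\<iota> = "case_sum (\<lambda>b. if b \<in> B then Inl b else Inr (Inl b)) (\<lambda>f. Inr (Inr f))"
  have "disjoint_family_on (\<lambda>k. path_arcs (P (?\<iota> k))) ((B \<union> J) <+> entering D X)"
    by (rule disjoint_family_on_reindex[OF disjoint]) (auto intro!: inj_onI split: if_splits)
  then show ?thesis
    unfolding t_good_def using assms(1-5)
    by (intro conjI exI[of _ "B \<union> J"] exI[of _ "\<lambda>k. P (?\<iota> k)"]) auto
qed

locale entry_linkage = good_set D S \<I> \<pi> t T B Q
  for D :: "('v, 'e) pre_digraph" and S :: "'s set" and \<I> :: "'s set set"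
    and \<pi> :: "'s \<Rightarrow> 'v set" and t T B Q +
  fixes L :: "'s set" and u :: "'s \<Rightarrow> 'v" and a :: "'s \<Rightarrow> 'e list"
  assumes indep: "B \<union> L \<in> \<I>" and L_outside: "L \<inter> rooted_in S \<pi> T = {}"
    and u_root: "j \<in> L \<Longrightarrow> u j \<in> \<pi> j"
    and a_walk: "j \<in> L \<Longrightarrow> entry_walk T (u j) (a j)"
    and a_distinct: "j \<in> L \<Longrightarrow> distinct (a j)"
    and a_disjoint: "disjoint_family_on (\<lambda>j. set (a j)) L"
begin

lemma L_Int_B: "L \<inter> B = {}"
  using L_outside base_ofD(2)[OF B_base] by blast

lemma u_outside: "j \<in> L \<Longrightarrow> u j \<notin> T"
  using L_outside u_root indep_subset_ground[OF indep] by (auto simp: rooted_in_def)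

lemma linkable_B_Un_L: "linkable D \<pi> (B \<union> L) {t}"
  using L_Int_B u_root u_outside a_walk a_disjoint by (intro linkable_entry_walks) auto

definition used_arcs :: "'e set" where
  "used_arcs = (\<Union>j\<in>L. set (a j))"

text \<open>A move from \<open>v\<close> to \<open>w\<close> turns a spare walk from \<open>v\<close> into \<open>T\<close> into one from \<open>w\<close>: extend it by
  an unused arc; hand it over to the walk of the linkage that uses \<open>f\<close>, whose remainder becomes
  spare; or hand it over to a root \<open>s\<close> that replaces \<open>j\<close>, whose walk becomes spare.\<close>

definition unused_move :: "'e \<Rightarrow> 'v \<Rightarrow> 'v \<Rightarrow> bool" where
  "unused_move f v w \<longleftrightarrow> f \<in> arcs D - used_arcs \<and> tail D f = w \<and> head D f = v"

definition used_move :: "'s \<Rightarrow> 'e \<Rightarrow> 'v \<Rightarrow> 'v \<Rightarrow> bool" where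
  "used_move j f v w \<longleftrightarrow> j \<in> L \<and> f \<in> set (a j) \<and> tail D f = v \<and> head D f = w"

definition exchange_move :: "'s \<Rightarrow> 's \<Rightarrow> 'v \<Rightarrow> 'v \<Rightarrow> bool" where
  "exchange_move j s v w \<longleftrightarrow>
     j \<in> L \<and> u j = w \<and> s \<in> S \<and> v \<in> \<pi> s \<and> s \<notin> span (B \<union> L - {j})"

definition residual_step :: "'v \<Rightarrow> 'v \<Rightarrow> bool" where
  "residual_step v w \<longleftrightarrow> w \<notin> T \<and>
     ((\<exists>f. unused_move f v w) \<or> (\<exists>j f. used_move j f v w) \<or> (\<exists>j s. exchange_move j s v w))"

definition exposed :: "'v \<Rightarrow> bool" where
  "exposed v \<longleftrightarrow> (\<exists>s\<in>S. v \<in> \<pi> s \<and> s \<notin> span (B \<union> L))"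

lemma residual_step_verts:
  assumes "residual_step v w"
  shows "w \<in> verts D - T"
proof -
  have "u j \<in> verts D" if "j \<in> L" for j
    using u_root[OF that] root_sub[of j] indep_subset_ground[OF indep] that by blast
  then show ?thesis
    using assms entry_walk_arcs[OF a_walk]
    unfolding residual_step_def unused_move_def used_move_def exchange_move_def by auto
qed

end

section \<open>A residually closed set without exposed vertices extends the good set\<close>

locale residual_closed = entry_linkage D S \<I> \<pi> t T B Q L u a
  for D :: "('v, 'e) pre_digraph" and S :: "'s set" and \<I> :: "'s set set"
    and \<pi> :: "'s \<Rightarrow> 'v set" and t T B Q L u a +
  fixes R :: "'v set"
  assumes R_verts: "R \<subseteq> verts D - T"
    and R_closed: "v \<in> R \<Longrightarrow> residual_step v w \<Longrightarrow> w \<in> R"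
    and R_unexposed: "v \<in> R \<Longrightarrow> \<not> exposed v"
begin

lemma used_arc_closed: "j \<in> L \<Longrightarrow> f \<in> set (a j) \<Longrightarrow> tail D f \<in> R \<Longrightarrow> head D f \<in> T \<union> R"
  using R_closed unfolding residual_step_def used_move_def by blast

lemma entering_unused_head:
  assumes "f \<in> entering D (T \<union> R)" "f \<notin> used_arcs"
  shows "head D f \<in> T"
  using assms R_closed unfolding residual_step_def unused_move_def entering_def by blast

lemma tails_subset_if_starts_inside:
  assumes "entry_walk T x p" "x \<in> T \<union> R" "j \<in> L" "set p \<subseteq> set (a j)"
  shows "tail D ` set p \<subseteq> R"
  using assms
proof (induction p arbitrary: x)
  case (Cons f p)
  then have f: "tail D f \<in> R" by auto
  then have "head D f \<in> T \<union> R" using Cons.prems(3,4) used_arc_closed by simp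
  then show ?case using Cons.IH[of "head D f"] Cons.prems f by simp
qed simp

lemma tails_subset_after_entering:
  assumes "j \<in> L" "a j = p @ f # l" "head D f \<in> T \<union> R"
  shows "tail D ` set l \<subseteq> R"
proof -
  have "entry_walk T (head D f) l"
    using entry_walk_suffix[of T "u j" p f l] a_walk[OF assms(1)] assms(2) by simp
  then show ?thesis using tails_subset_if_starts_inside assms by fastforce
qed

lemma entering_used_unique:
  assumes j: "j \<in> L" and fg: "f \<in> set (a j)" "g \<in> set (a j)"
    and entering: "f \<in> entering D (T \<union> R)" "g \<in> entering D (T \<union> R)"
  shows "f = g"
proof (rule ccontr)
  have not_after: "y \<notin> set l"
    if "a j = p @ x # l" "x \<in> entering D (T \<union> R)" "y \<in> entering D (T \<union> R)" for p x l y
    using tails_subset_after_entering[OF j that(1)] that(2,3) by (auto simp: entering_def)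
  assume "f \<noteq> g"
  obtain p l where pl: "a j = p @ f # l" using fg(1) by (auto simp: in_set_conv_decomp)
  then have "g \<in> set p" using not_after[OF pl] fg(2) entering \<open>f \<noteq> g\<close> by auto
  then obtain p' l' where "p = p' @ g # l'" by (auto simp: in_set_conv_decomp)
  then show False using not_after[of p' g "l' @ f # l" f] pl entering by simp
qed

definition inner_roots :: "'s set" where
  "inner_roots = {j \<in> L. u j \<in> R}"

lemma inner_walk_tails: "j \<in> inner_roots \<Longrightarrow> tail D ` set (a j) \<subseteq> R"
  using tails_subset_if_starts_inside[of "u j" "a j" j] a_walk by (simp add: inner_roots_def)

lemma base_of_inner_roots: "base_of \<I> (rooted_in S \<pi> (T \<union> R)) (B \<union> inner_roots)"
proof (rule base_ofI_span)
  show "B \<union> inner_roots \<in> \<I>"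
    by (rule indep_subset[OF indep]) (auto simp: inner_roots_def)
  show "B \<union> inner_roots \<subseteq> rooted_in S \<pi> (T \<union> R)"
    using base_ofD(2)[OF B_base] u_root indep_subset_ground[OF indep]
    unfolding inner_roots_def rooted_in_def by blast
  show "rooted_in S \<pi> (T \<union> R) \<subseteq> span (B \<union> inner_roots)"
  proof
    fix s assume s: "s \<in> rooted_in S \<pi> (T \<union> R)"
    show "s \<in> span (B \<union> inner_roots)"
    proof (cases "s \<in> rooted_in S \<pi> T")
      case False
      then obtain v where v: "v \<in> R" "v \<in> \<pi> s" "s \<in> S" using s by (auto simp: rooted_in_def)
      then have "s \<in> span (B \<union> L)" using R_unexposed by (auto simp: exposed_def)
      then show ?thesis
      proof (rule span_fundamental_circuit[OF indep])
        show "B \<union> inner_roots \<subseteq> B \<union> L" by (auto simp: inner_roots_def)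
        have "x \<in> inner_roots" if "x \<in> L" "s \<notin> span (B \<union> L - {x})" for x
          using R_closed[OF v(1), of "u x"] that v u_outside
          unfolding residual_step_def exchange_move_def inner_roots_def by blast
        then show "{x \<in> B \<union> L. s \<notin> span (B \<union> L - {x})} \<subseteq> B \<union> inner_roots" by blast
      qed
    qed (use rooted_in_subset_span in blast)
  qed
qed

lemma ex_continuation:
  assumes f: "f \<in> entering D (T \<union> R)"
  shows "\<exists>l. entry_walk T (tail D f) (f # l) \<and> tail D ` set l \<subseteq> R \<and>
    (l = [] \<or> (\<exists>j\<in>L. set (f # l) \<subseteq> set (a j)))"
proof (cases "f \<in> used_arcs")
  case True
  then obtain j p l where j: "j \<in> L" and eq: "a j = p @ f # l"
    by (auto simp: used_arcs_def in_set_conv_decomp)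
  have "entry_walk T (tail D f) (f # l)"
    using entry_walk_suffix[of T "u j"] a_walk[OF j] eq by simp
  moreover have "tail D ` set l \<subseteq> R"
    using tails_subset_after_entering[OF j eq] f by (simp add: entering_def)
  moreover have "set (f # l) \<subseteq> set (a j)" using eq by auto
  ultimately show ?thesis using j by blast
next
  case False
  then have "entry_walk T (tail D f) [f]"
    using entering_unused_head[OF f] f T_verts by (auto simp: entering_def)
  then show ?thesis by (intro exI[of _ "[]"]) simp
qed

lemma disjoint_inner_entering_walks:
  assumes l: "\<And>f. f \<in> entering D (T \<union> R) \<Longrightarrow> l f = [] \<or> (\<exists>j\<in>L. set (f # l f) \<subseteq> set (a j))"
  shows "disjoint_family_on (\<lambda>k. set (case_sum a (\<lambda>f. f # l f) k))
    (inner_roots <+> entering D (T \<union> R))"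
proof -
  have same: "i = j" if "i \<in> L" "j \<in> L" "x \<in> set (a i)" "x \<in> set (a j)" for i j x
    using disjoint_family_onD[OF a_disjoint that(1,2)] that(3,4) by blast
  have owner: "x = f \<or> (\<exists>j\<in>L. f \<in> set (a j) \<and> x \<in> set (a j))"
    if "f \<in> entering D (T \<union> R)" "x \<in> set (f # l f)" for f x
    using l[OF that(1)] that(2) by auto
  have inner_entering: "set (a j) \<inter> set (f # l f) = {}"
    if j: "j \<in> inner_roots" and f: "f \<in> entering D (T \<union> R)" for j f
  proof -
    have "f \<notin> set (a j)" using inner_walk_tails[OF j] f by (auto simp: entering_def)
    then show ?thesis using owner[OF f] same j unfolding inner_roots_def by blast
  qed
  have entering_entering: "set (f # l f) \<inter> set (g # l g) = {}"
    if fg: "f \<in> entering D (T \<union> R)" "g \<in> entering D (T \<union> R)" "f \<noteq> g" for f g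
  proof -
    have False if x: "x \<in> set (f # l f)" "x \<in> set (g # l g)" for x
    proof -
      have "\<exists>j\<in>L. f \<in> set (a j) \<and> g \<in> set (a j)"
        using owner[OF fg(1) x(1)] owner[OF fg(2) x(2)] fg(3) same[where x = x] by blast
      then show False using entering_used_unique fg by blast
    qed
    then show ?thesis by blast
  qed
  have "disjoint_family_on (\<lambda>j. set (a j)) inner_roots"
    by (rule disjoint_family_on_mono[OF _ a_disjoint]) (auto simp: inner_roots_def)
  moreover have "disjoint_family_on (\<lambda>f. set (f # l f)) (entering D (T \<union> R))"
    using entering_entering unfolding disjoint_family_on_def by blast
  ultimately show ?thesis
    unfolding sum.case_distrib[of set] using inner_entering by (rule disjoint_family_on_case_sum)
qed

theorem t_good_extension: "t_good D S \<I> \<pi> t (T \<union> R)"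
proof -
  let ?X = "T \<union> R" and ?M = "inner_roots <+> entering D (T \<union> R)"
  obtain l where l: "\<And>f. f \<in> entering D ?X \<Longrightarrow> entry_walk T (tail D f) (f # l f)"
    "\<And>f. f \<in> entering D ?X \<Longrightarrow> tail D ` set (l f) \<subseteq> R"
    "\<And>f. f \<in> entering D ?X \<Longrightarrow> l f = [] \<or> (\<exists>j\<in>L. set (f # l f) \<subseteq> set (a j))"
    using ex_continuation by metis
  let ?w = "case_sum a (\<lambda>f. f # l f)"
  let ?x = "case_sum u (head D)" and ?p = "case_sum a l"
  have w_disjoint: "disjoint_family_on (\<lambda>k. set (?w k)) ?M"
    using disjoint_inner_entering_walks[OF l(3)] .
  have w: "entry_walk T (case_sum u (tail D) k) (?w k) \<and> ?w k \<noteq> []" if "k \<in> ?M" for k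
    using that a_walk l(1) u_outside entry_walk_start_notin_iff[OF a_walk]
    by (auto simp: inner_roots_def)
  have walk: "awalk (?x k) (?p k) (head D (last (?w k)))" if "k \<in> ?M" for k
    using that entry_walk_awalk[of T _ "?w k"] w[OF that]
    by (elim PlusE) (auto simp: awalk_Cons_iff)
  have sub: "set (?p k) \<subseteq> set (?w k)" for k by (cases k) auto
  have tails: "tail D ` set (?p k) \<subseteq> ?X" if "k \<in> ?M" for k
    using that inner_walk_tails l(2) by (elim PlusE) (simp_all add: le_supI2)
  obtain P where P: "\<forall>b\<in>B. path_from_to (D \<restriction> ?X) (\<pi> b) (P (Inl b)) {t}"
    "\<forall>k\<in>?M. path_from_to (D \<restriction> ?X) {?x k} (P (Inr k)) {t}"
    and disjoint: "disjoint_family_on (\<lambda>k. path_arcs (P k)) (B <+> ?M)"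
    using ex_disjoint_paths_along_entry_walks[OF Un_upper1 w w_disjoint walk sub tails] by blast
  show ?thesis
  proof (rule t_goodI_path_system[OF _ base_of_inner_roots P(1) _ _ disjoint])
    show "\<forall>b\<in>inner_roots. path_from_to (D \<restriction> ?X) (\<pi> b) (P (Inr (Inl b))) {t}"
    proof
      fix b assume b: "b \<in> inner_roots"
      then have "u b \<in> \<pi> b" using u_root by (simp add: inner_roots_def)
      then show "path_from_to (D \<restriction> ?X) (\<pi> b) (P (Inr (Inl b))) {t}"
        using bspec[OF P(2) InlI[OF b]] by (auto simp: path_from_to_singleton)
    qed
    show "\<forall>f\<in>entering D ?X. path_from_to (D \<restriction> ?X) {head D f} (P (Inr (Inr f))) {t}"
      using bspec[OF P(2) InrI] by simp
  qed (use R_verts T_verts in blast)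
qed

end

section \<open>Augmentation along a shortest residual walk\<close>

text \<open>The vertices \<open>v 0, \<dots>, v n\<close> form a residual walk from the tail of the unused arc \<open>e\<close> to a
  vertex exposed by \<open>s n\<close>; its steps of the three kinds are numbered by \<open>U\<close>, \<open>V\<close> and \<open>W\<close>. The
  augmentation replaces only the finitely many touched walks: a sum telescoping along \<open>v\<close> shows that
  the net outflow of \<open>new_arcs\<close> equals the number of starts of \<open>new_roots\<close>, so that \<open>new_arcs\<close>
  decomposes into walks.\<close>

locale augmenting_walk = entry_linkage D S \<I> \<pi> t T B Q L u a
  for D :: "('v, 'e) pre_digraph" and S :: "'s set" and \<I> :: "'s set set"
    and \<pi> :: "'s \<Rightarrow> 'v set" and t T B Q L u a +
  fixes e :: 'e and n :: nat and v :: "nat \<Rightarrow> 'v" and U V W :: "nat set"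
    and f :: "nat \<Rightarrow> 'e" and j s :: "nat \<Rightarrow> 's"
  assumes e_entering: "e \<in> entering D T" and e_unused: "e \<notin> used_arcs"
    and v_0: "v 0 = tail D e"
    and v_inj: "inj_on v {..n}"
    and v_outside: "i \<le> n \<Longrightarrow> v i \<notin> T"
    and steps: "U \<union> V \<union> W = {..<n}" "U \<inter> V = {}" "(U \<union> V) \<inter> W = {}"
    and unused: "i \<in> U \<Longrightarrow> unused_move (f i) (v i) (v (Suc i))"
    and used: "i \<in> V \<Longrightarrow> used_move (j i) (f i) (v i) (v (Suc i))"
    and exchange: "i \<in> W \<Longrightarrow> exchange_move (j i) (s i) (v i) (v (Suc i))"
    and spanned: "i \<in> W \<Longrightarrow> s i \<in> span (B \<union> L)"
    and no_shortcut: "i \<in> W \<Longrightarrow> k \<in> W \<Longrightarrow> i < k \<Longrightarrow> s i \<in> span (B \<union> L - {j k})"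
    and s_n: "s n \<in> S" "v n \<in> \<pi> (s n)" "s n \<notin> span (B \<union> L)"
begin

definition touched :: "'s set" where
  "touched = j ` (V \<union> W)"

definition touched_arcs :: "'e set" where
  "touched_arcs = insert e (\<Union>k\<in>touched. set (a k))"

definition new_arcs :: "'e set" where
  "new_arcs = touched_arcs - f ` V \<union> f ` U"

definition new_roots :: "'s set" where
  "new_roots = touched - j ` W \<union> s ` insert n W"

definition new_start :: "'s \<Rightarrow> 'v" where
  "new_start k = (if k \<in> s ` insert n W then v (inv_into (insert n W) s k) else u k)"

lemma step_less: "i \<in> U \<union> V \<union> W \<Longrightarrow> i < n"
  using steps(1) by blast

lemma finite_steps: "finite U" "finite V" "finite W"
  using steps(1) finite_subset[of _ "{..<n}"] by blast+

lemma v_eq_iff: "i \<le> n \<Longrightarrow> k \<le> n \<Longrightarrow> v i = v k \<longleftrightarrow> i = k"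
  using inj_on_eq_iff[OF v_inj] by simp

lemma unused_arc:
  assumes "i \<in> U"
  shows "f i \<in> arcs D" "f i \<notin> used_arcs" "tail D (f i) = v (Suc i)" "head D (f i) = v i"
  using unused[OF assms] by (auto simp: unused_move_def)

lemma used_arc:
  assumes "i \<in> V"
  shows "f i \<in> set (a (j i))" "tail D (f i) = v i" "head D (f i) = v (Suc i)"
  using used[OF assms] by (auto simp: used_move_def)

lemma exchange_root:
  assumes "i \<in> W"
  shows "u (j i) = v (Suc i)" "s i \<in> S" "v i \<in> \<pi> (s i)" "s i \<notin> span (B \<union> L - {j i})"
  using exchange[OF assms] by (auto simp: exchange_move_def)

lemma touched_subset: "touched \<subseteq> L" and finite_touched: "finite touched"
  using used exchange finite_steps by (auto simp: touched_def used_move_def exchange_move_def)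

lemma inj_on_f: "inj_on f U" "inj_on f V"
  using unused_arc(4) used_arc(2) v_eq_iff step_less
  by (auto intro!: inj_onI) (metis UnCI order_less_imp_le)+

lemma inj_on_j: "inj_on j W"
  using exchange_root(1) v_eq_iff step_less by (intro inj_onI) (metis Suc_leI UnCI nat.inject)

lemma new_root_notin:
  assumes "i \<in> insert n W"
  shows "s i \<notin> B \<union> L - j ` W"
proof (cases "i = n")
  case False
  then have "i \<in> W" using assms by blast
  then show ?thesis using exchange_root(4) span_superset[of "B \<union> L - {j i}"] by blast
qed (use s_n(3) span_superset[of "B \<union> L"] in blast)

lemma new_root_notin_span_B:
  assumes "i \<in> insert n W"
  shows "s i \<notin> span B"
proof (cases "i = n")
  case False
  then have i: "i \<in> W" using assms by blast
  then have "B \<subseteq> B \<union> L - {j i}"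
    using touched_subset L_Int_B by (auto simp: touched_def)
  then show ?thesis using exchange_root(4)[OF i] span_mono by blast
qed (use s_n(3) span_mono[of B "B \<union> L"] in blast)

lemma inj_on_s: "inj_on s (insert n W)"
proof -
  have "s i \<noteq> s k" if "i \<in> W" "k \<in> W" "i < k" for i k
    using no_shortcut[OF that] exchange_root(4)[OF that(2)] by auto
  then have "inj_on s W" by (metis inj_onI linorder_neqE_nat)
  moreover have "s n \<notin> s ` W" using spanned s_n(3) by auto
  ultimately show ?thesis by auto
qed

lemma new_start_s: "i \<in> insert n W \<Longrightarrow> new_start (s i) = v i"
  by (simp only: new_start_def imageI if_True inv_into_f_f[OF inj_on_s])

lemma new_start_old: "k \<in> L - j ` W \<Longrightarrow> new_start k = u k"
  using new_root_notin by (auto simp: new_start_def)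

lemma new_arcs_subset: "new_arcs \<subseteq> arcs D" and tail_new_arcs: "tail D ` new_arcs \<inter> T = {}"
proof -
  have "x \<in> arcs D \<and> tail D x \<notin> T" if "x \<in> new_arcs" for x
    using that e_entering touched_subset entry_walk_arcs[OF a_walk] unused_arc(1,3)
      v_outside step_less
    by (auto simp: new_arcs_def touched_arcs_def entering_def Suc_leI)
  then show "new_arcs \<subseteq> arcs D" "tail D ` new_arcs \<inter> T = {}" by blast+
qed

lemma finite_touched_arcs: "finite touched_arcs"
  using finite_touched by (simp add: touched_arcs_def)

lemma untouched_Int_new_arcs:
  assumes "k \<in> L - touched"
  shows "set (a k) \<inter> new_arcs = {}"
proof -
  have "set (a k) \<inter> set (a i) = {}" if "i \<in> touched" for i
    using disjoint_family_onD[OF a_disjoint, of k i] assms that touched_subset by blast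
  moreover have "set (a k) \<subseteq> used_arcs" using assms by (auto simp: used_arcs_def)
  ultimately show ?thesis
    using e_unused unused_arc(2) by (auto simp: new_arcs_def touched_arcs_def)
qed

lemma net_outflow_touched_arcs:
  assumes "x \<notin> T"
  shows "net_outflow touched_arcs x = num_starts touched u x + of_bool (v 0 = x)"
proof -
  have "e \<notin> (\<Union>k\<in>touched. set (a k))" using e_unused touched_subset by (auto simp: used_arcs_def)
  moreover have "head D e \<noteq> x" using e_entering assms by (auto simp: entering_def)
  moreover have "net_outflow (\<Union>k\<in>touched. set (a k)) x = num_starts touched u x"
    using a_walk a_distinct touched_subset disjoint_family_on_mono[OF touched_subset a_disjoint]
    by (intro net_outflow_UN_entry_walks[OF finite_touched _ _ assms]) auto
  ultimately show ?thesis
    unfolding touched_arcs_def using finite_touched v_0 by (simp add: net_outflow_insert)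
qed

lemma net_outflow_new_arcs:
  "net_outflow new_arcs x = net_outflow touched_arcs x +
    (\<Sum>i\<in>U \<union> V. of_bool (v (Suc i) = x) - of_bool (v i = x))"
proof -
  have sub: "f ` V \<subseteq> touched_arcs"
    using used_arc(1) by (auto simp: touched_arcs_def touched_def)
  have "f i \<notin> touched_arcs" if "i \<in> U" for i
  proof -
    have "f i \<noteq> e"
      using v_eq_iff[of "Suc i" 0] step_less[of i] unused_arc(3)[OF that] v_0 that by auto
    then show ?thesis
      using unused_arc(2)[OF that] touched_subset by (auto simp: touched_arcs_def used_arcs_def)
  qed
  then have "(touched_arcs - f ` V) \<inter> f ` U = {}" by blast
  then have "net_outflow new_arcs x =
      net_outflow touched_arcs x - net_outflow (f ` V) x + net_outflow (f ` U) x"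
    unfolding new_arcs_def net_outflow_def
    using finite_touched_arcs finite_steps sub by (simp add: sum.union_disjoint sum_diff)
  also have "net_outflow (f ` V) x = - (\<Sum>i\<in>V. of_bool (v (Suc i) = x) - of_bool (v i = x))"
    unfolding net_outflow_def sum.reindex[OF inj_on_f(2)] sum_negf[symmetric]
    by (intro sum.cong) (simp_all add: used_arc)
  also have "net_outflow (f ` U) x = (\<Sum>i\<in>U. of_bool (v (Suc i) = x) - of_bool (v i = x))"
    unfolding net_outflow_def sum.reindex[OF inj_on_f(1)]
    by (intro sum.cong) (simp_all add: unused_arc)
  finally show ?thesis
    using finite_steps steps(2) by (simp add: sum.union_disjoint)
qed

lemma num_starts_new_roots:
  "num_starts new_roots new_start x = num_starts touched u x + of_bool (v n = x) -
    (\<Sum>i\<in>W. of_bool (v (Suc i) = x) - of_bool (v i = x))"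
proof -
  have disjoint: "(touched - j ` W) \<inter> s ` insert n W = {}"
    using new_root_notin touched_subset by blast
  have n: "n \<notin> W" using step_less by blast
  have "num_starts new_roots new_start x =
      num_starts (touched - j ` W) new_start x + num_starts (s ` insert n W) new_start x"
    unfolding new_roots_def num_starts_def
    using finite_touched finite_steps disjoint by (intro sum.union_disjoint) auto
  also have "num_starts (touched - j ` W) new_start x = num_starts (touched - j ` W) u x"
    unfolding num_starts_def using touched_subset new_start_old by (intro sum.cong) auto
  also have "\<dots> = num_starts touched u x - num_starts (j ` W) u x"
    unfolding num_starts_def using finite_touched by (intro sum_diff) (auto simp: touched_def)
  also have "num_starts (j ` W) u x = (\<Sum>i\<in>W. of_bool (v (Suc i) = x))"
    unfolding num_starts_def sum.reindex[OF inj_on_j]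
    by (intro sum.cong) (simp_all add: exchange_root)
  also have "num_starts (s ` insert n W) new_start x = (\<Sum>i\<in>insert n W. of_bool (v i = x))"
    unfolding num_starts_def sum.reindex[OF inj_on_s]
    by (intro sum.cong) (simp_all add: new_start_s)
  also have "\<dots> = of_bool (v n = x) + (\<Sum>i\<in>W. of_bool (v i = x))"
    using finite_steps n by (simp del: sum_of_bool_eq)
  finally show ?thesis by (simp add: sum_subtractf del: sum_of_bool_eq)
qed

lemma net_outflow_eq_num_starts:
  assumes "x \<notin> T"
  shows "net_outflow new_arcs x = num_starts new_roots new_start x"
proof -
  let ?d = "\<lambda>i. of_bool (v (Suc i) = x) - of_bool (v i = x) :: int"
  have "sum ?d (U \<union> V) + sum ?d W = sum ?d {..<n}"
    using finite_steps steps by (simp add: sum.union_disjoint[symmetric])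
  also have "\<dots> = of_bool (v n = x) - of_bool (v 0 = x)"
    by (rule sum_lessThan_telescope)
  finally show ?thesis
    unfolding net_outflow_new_arcs net_outflow_touched_arcs[OF assms] num_starts_new_roots by simp
qed

lemma new_start_root:
  assumes "k \<in> L - touched \<union> new_roots"
  shows "new_start k \<in> \<pi> k - T"
proof (cases "k \<in> s ` insert n W")
  case True
  then obtain i where i: "k = s i" "i \<in> insert n W" by blast
  then have "i \<le> n" using step_less[of i] by auto
  then show ?thesis using i new_start_s v_outside exchange_root(3) s_n(2) by auto
next
  case False
  then have "k \<in> L - j ` W" using assms touched_subset by (auto simp: new_roots_def touched_def)
  then show ?thesis using new_start_old u_root u_outside by simp
qed

lemma linkable_new_roots: "linkable D \<pi> (B \<union> (L - touched \<union> new_roots)) {t}"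
proof -
  have roots: "new_roots \<subseteq> L \<union> s ` insert n W" using touched_subset by (auto simp: new_roots_def)
  have "new_roots \<subseteq> S"
    using roots indep_subset_ground[OF indep] exchange_root(2) s_n(1) by blast
  then have "new_start ` new_roots \<subseteq> verts D" using new_start_root root_sub by blast
  moreover have "finite new_arcs" "finite new_roots"
    using finite_touched_arcs finite_touched finite_steps by (auto simp: new_arcs_def new_roots_def)
  ultimately obtain b
    where b: "\<forall>k\<in>new_roots. entry_walk T (new_start k) (b k) \<and> set (b k) \<subseteq> new_arcs"
    and b_disjoint: "disjoint_family_on (\<lambda>k. set (b k)) new_roots"
    using ex_disjoint_entry_walks[OF _ new_arcs_subset tail_new_arcs, of new_roots new_start]
      net_outflow_eq_num_starts by auto
  let ?c = "\<lambda>k. if k \<in> new_roots then b k else a k"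
  show ?thesis
  proof (rule linkable_entry_walks)
    show "(L - touched \<union> new_roots) \<inter> B = {}"
      using L_Int_B roots new_root_notin_span_B span_superset[of B] by blast
    show "disjoint_family_on (\<lambda>k. set (?c k)) (L - touched \<union> new_roots)"
      unfolding disjoint_family_on_def
    proof (intro ballI impI)
      fix k l assume kl: "k \<in> L - touched \<union> new_roots" "l \<in> L - touched \<union> new_roots" "k \<noteq> l"
      then show "set (?c k) \<inter> set (?c l) = {}"
        using disjoint_family_onD[OF b_disjoint, of k l] disjoint_family_onD[OF a_disjoint, of k l]
          bspec[OF b, of k] bspec[OF b, of l]
          untouched_Int_new_arcs[of k] untouched_Int_new_arcs[of l] by auto
    qed
    show "new_start k \<in> \<pi> k - T" if "k \<in> L - touched \<union> new_roots" for k
      using new_start_root[OF that] .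
    show "entry_walk T (new_start k) (?c k)" if "k \<in> L - touched \<union> new_roots" for k
    proof (cases "k \<in> new_roots")
      case False
      then have "k \<in> L - j ` W" using that by (auto simp: touched_def)
      then show ?thesis using False a_walk new_start_old by simp
    qed (use b in simp)
  qed
qed

theorem linkable_larger_span: "\<exists>I'\<in>\<I>. linkable D \<pi> I' {t} \<and> span (B \<union> L) \<subset> span I'"
proof -
  let ?K = "B \<union> L - j ` W \<union> s ` W"
  have j_L: "j i \<in> B \<union> L" if "i \<in> W" for i using that touched_subset by (auto simp: touched_def)
  have K: "?K \<in> \<I>" "B \<union> L \<subseteq> span ?K"
    using indep_exchange_sequence[of "B \<union> L" W j s]
      subset_span_exchange_sequence[of "B \<union> L" W j s]
      indep finite_steps(3) j_L spanned exchange_root(4) no_shortcut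
    by simp_all
  have ground: "B \<union> L \<subseteq> S" "?K \<subseteq> S" using indep_subset_ground indep K(1) by blast+
  have "?K \<subseteq> span (B \<union> L)" using spanned span_superset[of "B \<union> L"] by blast
  then have s_K: "s n \<notin> span ?K" using span_minimal[OF ground(1)] s_n(3) by blast
  then have "s n \<notin> ?K" using span_superset[of ?K] by blast
  then have "insert (s n) ?K \<in> \<I>" using indep_insert_iff[OF K(1) s_n(1)] s_K by blast
  moreover have "span (B \<union> L) \<subset> span (insert (s n) ?K)"
  proof -
    have "span (B \<union> L) \<subseteq> span (insert (s n) ?K)"
      using span_minimal[OF ground(2) K(2)] span_mono[OF subset_insertI] by blast
    then show ?thesis using s_n(3) span_superset[of "insert (s n) ?K"] by blast
  qed
  moreover have "B \<union> (L - touched \<union> new_roots) = insert (s n) ?K"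
    using touched_subset L_Int_B by (auto simp: new_roots_def touched_def)
  ultimately show ?thesis using linkable_new_roots by auto
qed

end

context entry_linkage
begin

lemma ex_classified_moves:
  assumes "\<forall>i<n. residual_step (v i) (v (Suc i))"
  shows "\<exists>U V W f j s. U \<union> V \<union> W = {..<n} \<and> U \<inter> V = {} \<and> (U \<union> V) \<inter> W = {} \<and>
    (\<forall>i\<in>U. unused_move (f i) (v i) (v (Suc i))) \<and>
    (\<forall>i\<in>V. used_move (j i) (f i) (v i) (v (Suc i))) \<and>
    (\<forall>i\<in>W. exchange_move (j i) (s i) (v i) (v (Suc i)))"
proof -
  define U where "U = {i. i < n \<and> (\<exists>f. unused_move f (v i) (v (Suc i)))}"
  define V where "V = {i. i < n \<and> i \<notin> U \<and> (\<exists>j f. used_move j f (v i) (v (Suc i)))}"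
  define W where "W = {..<n} - (U \<union> V)"
  have partition: "U \<union> V \<union> W = {..<n}" "U \<inter> V = {}" "(U \<union> V) \<inter> W = {}"
    by (auto simp: U_def V_def W_def)
  have "\<exists>f. unused_move f (v i) (v (Suc i))" if "i \<in> U" for i
    using that by (simp add: U_def)
  then obtain f where f: "\<And>i. i \<in> U \<Longrightarrow> unused_move (f i) (v i) (v (Suc i))" by metis
  have "\<exists>j g. used_move j g (v i) (v (Suc i))" if "i \<in> V" for i
    using that by (simp add: V_def)
  then obtain j g where jg: "\<And>i. i \<in> V \<Longrightarrow> used_move (j i) (g i) (v i) (v (Suc i))" by metis
  have "\<exists>k s. exchange_move k s (v i) (v (Suc i))" if "i \<in> W" for i
    using assms that unfolding U_def V_def W_def residual_step_def by blast
  then obtain k s where ks: "\<And>i. i \<in> W \<Longrightarrow> exchange_move (k i) (s i) (v i) (v (Suc i))" by metis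
  let ?f = "\<lambda>i. if i \<in> U then f i else g i" and ?j = "\<lambda>i. if i \<in> V then j i else k i"
  have unused: "unused_move (?f i) (v i) (v (Suc i))" if "i \<in> U" for i using f that by simp
  have used: "used_move (?j i) (?f i) (v i) (v (Suc i))" if "i \<in> V" for i
    using jg[OF that] that partition(2) by auto
  have exchange: "exchange_move (?j i) (s i) (v i) (v (Suc i))" if "i \<in> W" for i
    using ks[OF that] that partition(3) by auto
  show ?thesis
    by (intro exI[of _ U] exI[of _ V] exI[of _ W] exI[of _ ?f] exI[of _ ?j] exI[of _ s]
        conjI ballI partition unused used exchange)
qed

lemma ex_augmenting_walk:
  assumes e: "e \<in> entering D T" "e \<notin> used_arcs"
    and reach: "residual_step\<^sup>*\<^sup>* (tail D e) y" and y: "exposed y"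
  shows "\<exists>n v U V W f j s. augmenting_walk D S \<I> \<pi> t T B Q L u a e n v U V W f j s"
proof -
  obtain n v where v: "v 0 = tail D e" "exposed (v n)"
    and steps: "\<forall>i<n. residual_step (v i) (v (Suc i)) \<and> \<not> exposed (v i)"
    and no_shortcut: "\<forall>i k. Suc i < k \<longrightarrow> k \<le> n \<longrightarrow> \<not> residual_step (v i) (v k)"
    and inj: "inj_on v {..n}"
    using rtranclp_shortest_walk[of residual_step _ _ exposed, OF reach y] .
  obtain U V W f j s
    where partition: "U \<union> V \<union> W = {..<n}" "U \<inter> V = {}" "(U \<union> V) \<inter> W = {}"
      and moves: "\<forall>i\<in>U. unused_move (f i) (v i) (v (Suc i))"
        "\<forall>i\<in>V. used_move (j i) (f i) (v i) (v (Suc i))"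
        "\<forall>i\<in>W. exchange_move (j i) (s i) (v i) (v (Suc i))"
    using ex_classified_moves[of n v] steps by metis
  obtain r where r: "r \<in> S" "v n \<in> \<pi> r" "r \<notin> span (B \<union> L)"
    using v(2) by (auto simp: exposed_def)
  have outside: "v i \<notin> T" if "i \<le> n" for i
    using that v(1) e(1) steps by (cases i) (auto simp: residual_step_def entering_def Suc_le_eq)
  have "augmenting_walk D S \<I> \<pi> t T B Q L u a e n v U V W f j (s(n := r))"
  proof
    fix i assume i: "i \<in> W"
    then have "i < n" using partition(1) by blast
    then show "exchange_move (j i) ((s(n := r)) i) (v i) (v (Suc i))"
      "(s(n := r)) i \<in> span (B \<union> L)"
      using steps moves(3) i by (auto simp: exposed_def exchange_move_def)
    show "(s(n := r)) i \<in> span (B \<union> L - {j k})" if k: "k \<in> W" "i < k" for k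
    proof -
      have "k < n" using partition(1) k(1) by blast
      then have "\<not> residual_step (v i) (v (Suc k))" "v (Suc k) \<notin> T"
        using no_shortcut outside k(2) by auto
      then show ?thesis
        using bspec[OF moves(3) i] bspec[OF moves(3) k(1)] \<open>i < n\<close>
        unfolding residual_step_def exchange_move_def by auto
    qed
  qed (use e v(1) inj outside partition moves(1,2) r in auto)
  then show ?thesis by blast
qed

lemma linkable_larger_span_if_entering_unused:
  assumes e: "e \<in> entering D T" "e \<notin> used_arcs"
    and largest: "\<And>X. t_good D S \<I> \<pi> t X \<Longrightarrow> X \<subseteq> T"
  shows "\<exists>I'\<in>\<I>. linkable D \<pi> I' {t} \<and> span (B \<union> L) \<subset> span I'"
proof (cases "\<exists>y. residual_step\<^sup>*\<^sup>* (tail D e) y \<and> exposed y")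
  case True
  then obtain n v U V W f j s where "augmenting_walk D S \<I> \<pi> t T B Q L u a e n v U V W f j s"
    using ex_augmenting_walk[OF e] by blast
  then show ?thesis by (rule augmenting_walk.linkable_larger_span)
next
  case False
  let ?R = "{w. residual_step\<^sup>*\<^sup>* (tail D e) w}"
  interpret residual_closed D S \<I> \<pi> t T B Q L u a ?R
  proof
    have "w \<in> verts D - T" if "residual_step\<^sup>*\<^sup>* (tail D e) w" for w
      using that e(1) residual_step_verts by (cases rule: rtranclp.cases) (auto simp: entering_def)
    then show "?R \<subseteq> verts D - T" by blast
  qed (use False in \<open>auto intro: rtranclp.rtrancl_into_rtrancl\<close>)
  have "tail D e \<in> T" using largest[OF t_good_extension] by blast
  then show ?thesis using e(1) by (simp add: entering_def)
qed

end

section \<open>Cutting a linkage at its first arcs into a good set\<close>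

locale linked_good_set = good_set D S \<I> \<pi> t T B Q
  for D :: "('v, 'e) pre_digraph" and S :: "'s set" and \<I> :: "'s set set"
    and \<pi> :: "'s \<Rightarrow> 'v set" and t T B Q +
  fixes I :: "'s set" and P :: "'s \<Rightarrow> ('v, 'e) dpath"
  assumes I_indep: "I \<in> \<I>" and P_linkage: "linkage D \<pi> I {t} P" and t_in_T: "t \<in> T"
begin

abbreviation outer :: "'s set" where
  "outer \<equiv> I - rooted_in S \<pi> T"

abbreviation cut :: "'s \<Rightarrow> 'e list" where
  "cut i \<equiv> entry_prefix T (snd (P i))"

lemma P_path: "i \<in> I \<Longrightarrow> fst (P i) \<in> \<pi> i \<and> apath (fst (P i)) (snd (P i)) t"
  using P_linkage by (simp add: linkage_def path_from_to_singleton)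

lemma P_disjoint: "i \<in> I \<Longrightarrow> k \<in> I \<Longrightarrow> f \<in> set (snd (P i)) \<Longrightarrow> f \<in> set (snd (P k)) \<Longrightarrow> i = k"
  using P_linkage unfolding linkage_def path_arcs_def disjoint_family_on_def by blast

lemma entry_walk_cut: "i \<in> I \<Longrightarrow> entry_walk T (fst (P i)) (cut i)"
  using P_path t_in_T entry_walk_entry_prefix awalkI_apath by blast

lemma cut_entering:
  assumes "i \<in> outer"
  shows "set (cut i) \<inter> entering D T = {last (cut i)}"
proof -
  have "fst (P i) \<notin> T"
    using P_path assms indep_subset_ground[OF I_indep] by (auto simp: rooted_in_def)
  then have "cut i \<noteq> []" using entry_walk_cut assms entry_walk_start_notin_iff by blast
  then show ?thesis using entry_walk_Int_entering entry_walk_cut assms by blast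
qed

lemma entry_linkage_cut:
  assumes "B \<union> L \<in> \<I>" "L \<subseteq> outer"
  shows "entry_linkage D S \<I> \<pi> t T B Q L (\<lambda>i. fst (P i)) cut"
proof
  show "B \<union> L \<in> \<I>" "L \<inter> rooted_in S \<pi> T = {}" using assms by auto
  show "disjoint_family_on (\<lambda>j. set (cut j)) L"
    using assms(2) P_disjoint set_entry_prefix_subset unfolding disjoint_family_on_def by blast
  fix i assume "i \<in> L"
  then have i: "i \<in> I" using assms(2) by blast
  show "fst (P i) \<in> \<pi> i" using P_path[OF i] ..
  show "entry_walk T (fst (P i)) (cut i)" using entry_walk_cut[OF i] .
  show "distinct (cut i)"
    using P_path[OF i] distinct_verts_imp_distinct distinct_entry_prefix
    unfolding apath_def by blast
qed

lemma entering_arc_of_path: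
  assumes L: "L \<subseteq> outer" "entering D T \<subseteq> (\<Union>i\<in>L. set (cut i))"
    and f: "i \<in> I" "f \<in> set (snd (P i))" "f \<in> entering D T"
  shows "i \<in> L" "f = last (cut i)"
proof -
  obtain k where k: "k \<in> L" "f \<in> set (cut k)" using L(2) f(3) by blast
  then have "i = k" using P_disjoint[of i k f] f L(1) set_entry_prefix_subset by blast
  then show "i \<in> L" "f = last (cut i)" using k cut_entering[of k] f(3) L(1) by blast+
qed

lemma complementarity_if_entering_used:
  assumes L: "B \<union> L \<in> \<I>" "L \<subseteq> outer" "entering D T \<subseteq> (\<Union>i\<in>L. set (cut i))"
    and spans: "rooted_in S \<pi> T \<subseteq> span I"
  shows "complementarity D S \<I> \<pi> I P T"
proof -
  note entering_arc = entering_arc_of_path[OF L(2,3)]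
  have last_cut: "last (cut i) \<in> set (snd (P i)) \<inter> entering D T" if "i \<in> outer" for i
    using cut_entering[OF that] set_entry_prefix_subset by blast
  then have "L = outer" using entering_arc(1) L(2) by blast
  then have "base_of \<I> (rooted_in S \<pi> T) (I \<inter> rooted_in S \<pi> T)"
    using base_of_Int_if_spans[OF I_indep rooted_in_subset spans B_base] L(1) by simp
  moreover have "path_verts D (P i) \<subseteq> verts (D \<restriction> T) \<and> path_arcs (P i) \<subseteq> arcs (D \<restriction> T)"
    if i: "i \<in> I \<inter> rooted_in S \<pi> T" for i
  proof -
    have walk: "awalk (fst (P i)) (snd (P i)) t" using P_path i awalkI_apath by blast
    have "set (snd (P i)) \<inter> entering D T = {}" using entering_arc(1) L(2) i by blast
    then have inside: "set (awalk_verts (fst (P i)) (snd (P i))) \<subseteq> T"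
      using awalk_verts_subset_if_no_entering_arc walk t_in_T by blast
    then show ?thesis
      using awalk_induce[OF walk inside]
      by (simp add: path_verts_def path_arcs_def pre_digraph.awalk_def)
  qed
  moreover have "card (path_arcs (P i) \<inter> entering D T) = 1" if i: "i \<in> outer" for i
  proof -
    have "path_arcs (P i) \<inter> entering D T = {last (cut i)}"
      using entering_arc(2) last_cut[OF i] i by (auto simp: path_arcs_def)
    then show ?thesis by simp
  qed
  moreover have "entering D T \<subseteq> (\<Union>i\<in>outer. path_arcs (P i))"
    using L(2,3) set_entry_prefix_subset by (fastforce simp: path_arcs_def)
  ultimately show ?thesis unfolding complementarity_def Let_def by blast
qed

lemma ex_spanning_outer_subset:
  obtains L where "B \<union> L \<in> \<I>" "L \<subseteq> outer" "I \<subseteq> span (B \<union> L)"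
proof -
  have ground: "B \<union> outer \<subseteq> S"
    using indep_subset_ground[OF I_indep] indep_subset_ground[OF base_ofD(1)[OF B_base]] by blast
  obtain K where K: "base_of \<I> (B \<union> outer) K" "B \<subseteq> K"
    using indep_extends_to_base_of[OF base_ofD(1)[OF B_base] Un_upper1 ground] .
  then have B_Un: "B \<union> (K - B) = K" by blast
  have "outer \<subseteq> span K" using base_of_subset_span[OF K(1) ground] by blast
  then have "I \<subseteq> span K" using rooted_in_subset_span[of "K - B"] unfolding B_Un by blast
  then show thesis using that[of "K - B"] base_ofD[OF K(1)] B_Un by auto
qed

theorem ex_linkable_larger_span:
  assumes largest: "\<And>X. t_good D S \<I> \<pi> t X \<Longrightarrow> X \<subseteq> T"
    and "\<not> complementarity D S \<I> \<pi> I P T"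
  shows "\<exists>I'\<in>\<I>. linkable D \<pi> I' {t} \<and> span I \<subset> span I'"
proof -
  obtain L where L: "B \<union> L \<in> \<I>" "L \<subseteq> outer" and I_span: "I \<subseteq> span (B \<union> L)"
    by (rule ex_spanning_outer_subset)
  interpret entry_linkage D S \<I> \<pi> t T B Q L "\<lambda>i. fst (P i)" cut
    by (rule entry_linkage_cut[OF L])
  have span_le: "span I \<subseteq> span (B \<union> L)" using span_minimal I_span indep_subset_ground L(1) by blast
  show ?thesis
  proof (cases "span I = span (B \<union> L)")
    case True
    then have "rooted_in S \<pi> T \<subseteq> span I" using rooted_in_subset_span by simp
    then obtain e where "e \<in> entering D T" "e \<notin> used_arcs"
      using complementarity_if_entering_used[OF L] assms(2) unfolding used_arcs_def by blast
    then show ?thesis using linkable_larger_span_if_entering_unused largest True by simp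
  next
    case False
    then show ?thesis using linkable_B_Un_L L(1) span_le by blast
  qed
qed

end

lemma (in matroid_rooted_digraph) t_good_singleton:
  assumes "t \<in> verts D"
  shows "t_good D S \<I> \<pi> t {t}"
proof -
  obtain B where B: "base_of \<I> (rooted_in S \<pi> {t}) B"
    using indep_extends_to_base_of[OF indep_empty _ rooted_in_subset] by blast
  interpret loop: wf_digraph "D \<restriction> {t}" by (rule wellformed_induce_subgraph)
  have "loop.apath t [] t" by (simp add: loop.apath_Nil_iff)
  then show ?thesis
    unfolding t_good_def using assms B base_ofD(2)[OF B]
    by (intro conjI exI[of _ B] exI[of _ "\<lambda>_. (t, [])"])
      (auto simp: path_from_to_singleton rooted_in_def entering_def path_arcs_def
        disjoint_family_on_def)
qed

lemma (in matroid_rooted_digraph) t_good_imp_good_set: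
  assumes "t_good D S \<I> \<pi> t T"
  obtains B Q where "good_set D S \<I> \<pi> t T B Q"
  using assms matroid_rooted_digraph_axioms
  unfolding t_good_def good_set_def good_set_axioms_def by blast

theorem mainTheorem4:
  fixes D :: "('v, 'e) pre_digraph"
    and S :: "'s set" and \<I> :: "'s set set" and \<pi> :: "'s \<Rightarrow> 'v set"
    and t :: 'v and T :: "'v set"
    and I :: "'s set" and P :: "'s \<Rightarrow> ('v, 'e) dpath"
  assumes "matroid_rooted_digraph D S \<I> \<pi>"
    and "t \<in> verts D"
    and "largest_t_good D S \<I> \<pi> t T"
    and "I \<in> \<I>"
    and "linkage D \<pi> I {t} P"
    and "\<not> complementarity D S \<I> \<pi> I P T"
  shows "\<exists>I'\<in>\<I>. linkable D \<pi> I' {t} \<and> matroid_span S \<I> I \<subset> matroid_span S \<I> I'"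
proof -
  interpret matroid_rooted_digraph D S \<I> \<pi> by fact
  have good: "t_good D S \<I> \<pi> t T" and largest: "\<And>X. t_good D S \<I> \<pi> t X \<Longrightarrow> X \<subseteq> T"
    using assms(3) unfolding largest_t_good_def by blast+
  have "t \<in> T" using largest[OF t_good_singleton[OF assms(2)]] by blast
  obtain B Q where "good_set D S \<I> \<pi> t T B Q" using t_good_imp_good_set[OF good] .
  then interpret linked_good_set D S \<I> \<pi> t T B Q I P
    using assms(4,5) \<open>t \<in> T\<close> by (simp add: linked_good_set_def linked_good_set_axioms_def)
  show ?thesis using ex_linkable_larger_span[OF largest assms(6)] .
qed

end
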